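(* Assume conditions (i)–(vii) listed in the context. Let $\varepsilon_n\downarrow 0$ be a fixed sequence of positive numbers and let $(\hat\lambda^{(1)}_n,\hat\beta^{(1)}_n)$ be any Borel measurable function of the observations $(Y_i,\Delta_i,W_i)$, $i=1,\dots,n$, with values in $K=K_\lambda\times\Theta_\beta$, such that $$Q_n^{cor}(\hat\lambda^{(1)}_n,\hat\beta^{(1)}_n)\ \ge\ \sup_{(\lambda,\beta)\in K}Q_n^{cor}(\lambda,\beta)-\varepsilon_n .$$ Then $(\hat\lambda^{(1)}_n,\hat\beta^{(1)}_n)$ is strongly consistent: almost surely, as $n\to\infty$, $$\max_{t\in[0,\tau]}|\hat\lambda^{(1)}_n(t)-\lambda_0(t)|\to 0\quad\text{and}\quad \hat\beta^{(1)}_n\to\beta_0 .$$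
   Context: Model: a lifetime $T$ has conditional hazard $\lambda(t\mid X)=\lambda_0(t)\exp(\beta_0^TX)$, $t\ge 0$, given a random covariate $X\in\mathbb R^m$, where $\lambda_0\in C[0,\tau]$ is the baseline hazard and $\beta_0\in\mathbb R^m$. A censor $C$ takes values in $[0,\tau]$ ($\tau$ known, survival function of $C$ unknown). One observes $Y=\min\{T,C\}$, $\Delta=I_{\{T\le C\}}$ and $W=X+U$, where the measurement error $U$ has known moment generating function $M_U(z)=\mathsf E e^{z^TU}$; the pair $(T,X)$, $C$ and $U$ are mutually independent. The data $(Y_i,\Delta_i,W_i)$, $i=1,\dots,n$, come from i.i.d. copies $(X_i,T_i,C_i,U_i)$ of the model. Objective function: $$Q_n^{cor}(\lambda,\beta)=\frac1n\sum_{i=1}^n q(Y_i,\Delta_i,W_i;\lambda,\beta),\quad q(Y,\Delta,W;\lambda,\beta)=\Delta(\log\lambda(Y)+\beta^TW)-\frac{\exp(\beta^TW)}{M_U(\beta)}\int_0^Y\lambda(u)\,du,$$ with the convention that if $\lambda(Y)=0$ then $\Delta\log\lambda(Y)=0$ when $\Delta=0$ and $=-\infty$ when $\Delta=1$. Conditions: (i) $K_\lambda=\{f:[0,\tau]\to\mathbb R:\ f(t)\ge0\ \forall t,\ |f(t)-f(s)|\le L|t-s|\ \forall t,s\in[0,\tau]\}$ for a fixed constant $L>0$. (ii) $\Theta_\beta\subset\mathbb R^m$ is compact. (iii) $\mathsf EU=0$ and $\mathsf E e^{D\|U\|}<\infty$ where $D=\max_{\beta\in\Theta_\beta}\|\beta\|+\epsilon$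 for some $\epsilon>0$. (iv) $\mathsf E e^{D\|X\|}<\infty$ with the same $D$. (v) $\mathsf P(C>\tau)=0$ and $\mathsf P(C>\tau-\epsilon)>0$ for all $\epsilon>0$. (vi) The covariance matrix of $X$ is positive definite. (vii) $(\lambda_0,\beta_0)\in K:=K_\lambda\times\Theta_\beta$ and $\lambda_0(t)>0$ for all $t\in[0,\tau]$. *)

theory Defs
  imports "HOL-Probability.Probability"
begin

text \<open>The class K_lambda of nonnegative L-Lipschitz functions on [0,tau]
  (values outside [0,tau] are irrelevant).\<close>
definition Klam :: "real \<Rightarrow> real \<Rightarrow> (real \<Rightarrow> real) set" where
  "Klam L tau = {f. (\<forall>t\<in>{0..tau}. 0 \<le> f t) \<and>
      (\<forall>t\<in>{0..tau}. \<forall>s\<in>{0..tau}. \<bar>f t - f s\<bar> \<le> L * \<bar>t - s\<bar>)}"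

definition mgf :: "'a measure \<Rightarrow> ('a \<Rightarrow> real^'m) \<Rightarrow> real^'m \<Rightarrow> real" where
  "mgf M U z = integral\<^sup>L M (\<lambda>w. exp (z \<bullet> U w))"

definition cov_matrix :: "'a measure \<Rightarrow> ('a \<Rightarrow> real^'m) \<Rightarrow> real^'m^'m" where
  "cov_matrix M X = (\<chi> i j. integral\<^sup>L M (\<lambda>w.
      (X w $ i - integral\<^sup>L M (\<lambda>v. X v $ i)) * (X w $ j - integral\<^sup>L M (\<lambda>v. X v $ j))))"

definition pos_def_matrix :: "real^'m^'m \<Rightarrow> bool" where
  "pos_def_matrix A \<longleftrightarrow> (\<forall>v. v \<noteq> 0 \<longrightarrow> v \<bullet> (A *v v) > 0)"

text \<open>Contribution q(Y,Delta,W; lambda,beta), extended-real valued to encode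
  the convention log 0 = -infinity when Delta = 1.\<close>
definition qfun :: "(real^'m \<Rightarrow> real) \<Rightarrow> real \<times> bool \<times> (real^'m)
      \<Rightarrow> (real \<Rightarrow> real) \<times> (real^'m) \<Rightarrow> ereal" where
  "qfun MU obs par = (case obs of (y, d, w) \<Rightarrow> case par of (lam, b) \<Rightarrow>
      (if d then (if lam y = 0 then -\<infinity> else ereal (ln (lam y) + b \<bullet> w)) else 0)
      - ereal (exp (b \<bullet> w) / MU b * integral {0..y} lam))"

definition Qcor :: "(real^'m \<Rightarrow> real) \<Rightarrow> nat \<Rightarrow> (nat \<Rightarrow> real \<times> bool \<times> (real^'m))
      \<Rightarrow> (real \<Rightarrow> real) \<times> (real^'m) \<Rightarrow> ereal" where
  "Qcor MU n z par = ereal (1 / real n) * (\<Sum>i<n. qfun MU (z i) par)"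

definition observ :: "real \<Rightarrow> real \<Rightarrow> real^'m \<Rightarrow> real^'m \<Rightarrow> real \<times> bool \<times> (real^'m)" where
  "observ t c x u = (min t c, t \<le> c, x + u)"

end

theory Submission
  imports Defs "HOL-Complex_Analysis.Great_Picard"
begin

text \<open>The proof follows Wald.  With \<open>a = \<lambda>(u) exp(\<beta>\<^sup>T X)\<close> and \<open>a\<^sub>0\<close> the same expression at the true
  parameter, the deconvolution factor \<open>1 / M\<^sub>U(\<beta>)\<close> and the compensator of the event indicator give
  \<open>E q(\<lambda>,\<beta>) - E q(\<lambda>\<^sub>0,\<beta>\<^sub>0) = E \<integral>\<^sub>0\<^sup>Y (a\<^sub>0 ln (a / a\<^sub>0) - a + a\<^sub>0) du\<close>, and the elementary bound
  \<open>ln r \<le> 2 (\<surd>r - 1)\<close> turns this into at most \<open>- E \<integral>\<^sub>0\<^sup>Y (\<surd>a - \<surd>a\<^sub>0)\<^sup>2 du\<close>.  This is negative unless the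
  parameters agree, because \<open>C\<close> charges every left neighbourhood of \<open>\<tau>\<close> and no nontrivial linear
  combination of the components of \<open>X\<close> is constant.  By dominated convergence a neighbourhood of every wrong
  parameter has an integrable upper bound of \<open>q - q\<^sub>0\<close> with negative mean, and the strong law excludes that
  the estimator lies there for large \<open>n\<close>.  Hazards with large \<open>\<lambda>(0)\<close> are excluded since
  the logarithm loses against the integral term; the remaining parameters form a compact set by
  Arzela-Ascoli, so finitely many neighbourhoods suffice.\<close>

section \<open>The strong law of large numbers\<close>

text \<open>The recursion for the maximum of the partial sums runs along the shift of \<open>\<omega>\<close>, so that
  the maximum can be compared with its own shift.\<close>

primrec run_max :: "('b \<Rightarrow> real) \<Rightarrow> nat \<Rightarrow> (nat \<Rightarrow> 'b) \<Rightarrow> real" where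
  "run_max h 0 \<omega> = 0"
| "run_max h (Suc n) \<omega> = max 0 (h (\<omega> 0) + run_max h n (\<lambda>i. \<omega> (Suc i)))"

lemma run_max_nonneg: "0 \<le> run_max h n \<omega>"
  by (cases n) auto

lemma run_max_Suc_ge: "run_max h n \<omega> \<le> run_max h (Suc n) \<omega>"
proof (induction n arbitrary: \<omega>)
  case (Suc n)
  from Suc[of "\<lambda>i. \<omega> (Suc i)"] show ?case
    unfolding run_max.simps(2)[of h "Suc n"] run_max.simps(2)[of h n \<omega>] by linarith
qed simp

lemma run_max_mono: "m \<le> n \<Longrightarrow> run_max h m \<omega> \<le> run_max h n \<omega>"
  by (rule lift_Suc_mono_le[of "\<lambda>n. run_max h n \<omega>"]) (rule run_max_Suc_ge)

lemma sum_le_run_max: "(\<Sum>i<n. h (\<omega> i)) \<le> run_max h n \<omega>"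
proof (induction n arbitrary: \<omega>)
  case (Suc n)
  have "(\<Sum>i<Suc n. h (\<omega> i)) = h (\<omega> 0) + (\<Sum>i<n. h (\<omega> (Suc i)))"
    by (rule sum.lessThan_Suc_shift)
  with Suc[of "\<lambda>i. \<omega> (Suc i)"] show ?case by simp
qed simp

lemma run_max_unbounded_shift:
  "(\<forall>B::nat. \<exists>n. real B < run_max h n \<omega>) \<longleftrightarrow> (\<forall>B::nat. \<exists>n. real B < run_max h n (\<lambda>i. \<omega> (Suc i)))"
  (is "?L \<longleftrightarrow> ?R")
proof
  assume L: ?L
  show ?R
  proof
    fix B :: nat
    obtain B' :: nat where B': "real B + \<bar>h (\<omega> 0)\<bar> \<le> real B'" using real_arch_simple by blast
    obtain n where n: "real B' < run_max h n \<omega>" using L by blast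
    then obtain m where "n = Suc m" by (cases n) auto
    with n B' have "real B < run_max h m (\<lambda>i. \<omega> (Suc i))" by (auto simp: max_def split: if_splits)
    then show "\<exists>n. real B < run_max h n (\<lambda>i. \<omega> (Suc i))" by blast
  qed
next
  assume R: ?R
  show ?L
  proof
    fix B :: nat
    obtain B' :: nat where B': "real B + \<bar>h (\<omega> 0)\<bar> \<le> real B'" using real_arch_simple by blast
    obtain n where n: "real B' < run_max h n (\<lambda>i. \<omega> (Suc i))" using R by blast
    with B' have "real B < run_max h (Suc n) \<omega>" by auto
    then show "\<exists>n. real B < run_max h n \<omega>" by blast
  qed
qed

context sequence_space
begin

lemma measurable_shift [measurable]: "(\<lambda>\<omega> i. \<omega> (Suc i)) \<in> S \<rightarrow>\<^sub>M S"
  by (rule measurable_PiM_single') (auto simp: space_PiM)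

lemma measurable_run_max:
  assumes [measurable]: "h \<in> borel_measurable M"
  shows "run_max h n \<in> borel_measurable S"
proof (induction n)
  case (Suc n)
  note [measurable] = Suc
  show ?case by simp
qed simp

lemma measurable_case_nat_pair: "(\<lambda>(s, \<omega>). case_nat s \<omega>) \<in> M \<Otimes>\<^sub>M S \<rightarrow>\<^sub>M S"
  by measurable

lemma pair_prob_space_S: "pair_prob_space M S" 
  by unfold_locales

lemma integral_S_iter:
  fixes f :: "(nat \<Rightarrow> 'a) \<Rightarrow> real"
  assumes "f \<in> borel_measurable S"
  shows "(\<integral>\<omega>. f \<omega> \<partial>S) = (\<integral>p. f (case_nat (fst p) (snd p)) \<partial>(M \<Otimes>\<^sub>M S))"
    and "integrable S f \<longleftrightarrow> integrable (M \<Otimes>\<^sub>M S) (\<lambda>p. f (case_nat (fst p) (snd p)))"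
  using integral_distr[OF measurable_case_nat_pair assms]
    integrable_distr_eq[OF measurable_case_nat_pair assms]
  unfolding PiM_iter by (auto simp: case_prod_beta)

lemma integrable_fst: 
  fixes h :: "'a \<Rightarrow> real"
  assumes "integrable M h" shows "integrable (M \<Otimes>\<^sub>M S) (\<lambda>p. h (fst p))"
proof -
  interpret R: pair_prob_space M S by (rule pair_prob_space_S)
  have "distr (M \<Otimes>\<^sub>M S) M fst = M" by (rule P.distr_pair_fst)
  then show ?thesis using assms integrable_distr_eq[of fst "M \<Otimes>\<^sub>M S" M h] by auto
qed

lemma integral_snd: 
  fixes f :: "(nat \<Rightarrow> 'a) \<Rightarrow> real"
  assumes "f \<in> borel_measurable S" 
  shows "(\<integral>p. f (snd p) \<partial>(M \<Otimes>\<^sub>M S)) = (\<integral>\<omega>. f \<omega> \<partial>S)" 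
    "integrable (M \<Otimes>\<^sub>M S) (\<lambda>p. f (snd p)) \<longleftrightarrow> integrable S f"
proof -
  interpret Q: pair_prob_space S M using pair_prob_space_S unfolding pair_prob_space_def pair_sigma_finite_def by simp
  interpret R: pair_prob_space M S by (rule pair_prob_space_S)
  have "distr (M \<Otimes>\<^sub>M S) S snd = distr (distr (S \<Otimes>\<^sub>M M) (M \<Otimes>\<^sub>M S) (\<lambda>(x, y). (y, x))) S snd"
    by (subst R.distr_pair_swap) simp
  also have "\<dots> = distr (S \<Otimes>\<^sub>M M) S fst"
    by (subst distr_distr) (auto simp: comp_def case_prod_beta)
  also have "\<dots> = S" by (rule M.distr_pair_fst)
  finally have eq: "distr (M \<Otimes>\<^sub>M S) S snd = S" .
  show "(\<integral>p. f (snd p) \<partial>(M \<Otimes>\<^sub>M S)) = (\<integral>\<omega>. f \<omega> \<partial>S)" 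
    "integrable (M \<Otimes>\<^sub>M S) (\<lambda>p. f (snd p)) \<longleftrightarrow> integrable S f"
    using integral_distr[of snd "M \<Otimes>\<^sub>M S" S f] integrable_distr_eq[of snd "M \<Otimes>\<^sub>M S" S f] assms eq by auto
qed

text \<open>Since \<open>run_max h (Suc n) - run_max h n\<close> composed with the shift is \<open>max (- run_max h n) h\<close>,
  which tends to \<open>h (\<omega> 0)\<close> where the running maximum is unbounded, and this event is
  independent of \<open>\<omega> 0\<close>, unboundedness with positive probability forces \<open>E h \<ge> 0\<close>.\<close>

lemma AE_run_max_bounded:
  assumes h: "integrable M h" and neg: "(\<integral>x. h x \<partial>M) < 0"
  shows "AE \<omega> in S. \<exists>B::nat. \<forall>n. run_max h n \<omega> \<le> real B"
proof -
  have hm [measurable]: "h \<in> borel_measurable M" using h by simp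
  note [measurable] = measurable_run_max[OF hm]
  interpret R: pair_prob_space M S by (rule pair_prob_space_S)
  define A where "A = {\<omega> \<in> space S. \<forall>B::nat. \<exists>n. real B < run_max h n \<omega>}"
  have [measurable]: "A \<in> sets S" unfolding A_def by measurable
  have A_case: "case_nat z \<omega> \<in> A \<longleftrightarrow> \<omega> \<in> A" if "z \<in> space M" "\<omega> \<in> space S" for z \<omega>
  proof -
    have "case_nat z \<omega> \<in> space S" using that by (auto simp: space_PiM PiE_iff split: nat.split)
    then show ?thesis using that run_max_unbounded_shift[of h "case_nat z \<omega>"] by (simp add: A_def)
  qed
  have int_max: "integrable S (run_max h n)" for n
  proof (induction n)
    case (Suc n)
    have "integrable (M \<Otimes>\<^sub>M S) (\<lambda>p. max 0 (h (fst p) + run_max h n (snd p)))"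
      using integrable_fst[OF h] Suc integral_snd(2)[OF measurable_run_max[OF hm], of n]
      by (intro integrable_max Bochner_Integration.integrable_add) auto
    then show ?case by (subst integral_S_iter(2)) auto
  qed simp
  have intA: "integrable S (\<lambda>\<omega>. run_max h n \<omega> * indicator A \<omega>)" for n
    by (intro integrable_real_mult_indicator int_max) measurable
  define J where "J n = (\<integral>p. max (- run_max h n (snd p)) (h (fst p)) * indicator A (snd p) \<partial>(M \<Otimes>\<^sub>M S))" for n
  have J_nonneg: "0 \<le> J n" for n
  proof -
    have "(\<integral>\<omega>. run_max h n \<omega> * indicator A \<omega> \<partial>S) \<le> (\<integral>\<omega>. run_max h (Suc n) \<omega> * indicator A \<omega> \<partial>S)"
      by (intro integral_mono intA mult_right_mono run_max_Suc_ge) auto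
    also have "\<dots> = (\<integral>p. run_max h (Suc n) (case_nat (fst p) (snd p)) * indicator A (case_nat (fst p) (snd p)) \<partial>(M \<Otimes>\<^sub>M S))"
      by (rule integral_S_iter) measurable
    also have "\<dots> = (\<integral>p. max 0 (h (fst p) + run_max h n (snd p)) * indicator A (snd p) \<partial>(M \<Otimes>\<^sub>M S))"
      by (rule Bochner_Integration.integral_cong) (auto simp: space_pair_measure A_case indicator_def)
    finally have 1: "(\<integral>\<omega>. run_max h n \<omega> * indicator A \<omega> \<partial>S)
        \<le> (\<integral>p. max 0 (h (fst p) + run_max h n (snd p)) * indicator A (snd p) \<partial>(M \<Otimes>\<^sub>M S))" .
    have i1: "integrable (M \<Otimes>\<^sub>M S) (\<lambda>p. run_max h n (snd p) * indicator A (snd p))"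
      using integral_snd(2)[of "\<lambda>\<omega>. run_max h n \<omega> * indicator A \<omega>"] intA by simp
    have "integrable (M \<Otimes>\<^sub>M S) (\<lambda>p. run_max h (Suc n) (case_nat (fst p) (snd p)) * indicator A (case_nat (fst p) (snd p)))"
      using integral_S_iter(2)[of "\<lambda>\<omega>. run_max h (Suc n) \<omega> * indicator A \<omega>"] intA[of "Suc n"] by simp
    then have i2: "integrable (M \<Otimes>\<^sub>M S) (\<lambda>p. max 0 (h (fst p) + run_max h n (snd p)) * indicator A (snd p))"
      by (rule Bochner_Integration.integrable_cong[THEN iffD1, rotated 2])
         (auto simp: space_pair_measure A_case indicator_def)
    have "J n = (\<integral>p. max 0 (h (fst p) + run_max h n (snd p)) * indicator A (snd p)
         - run_max h n (snd p) * indicator A (snd p) \<partial>(M \<Otimes>\<^sub>M S))"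
      unfolding J_def by (rule Bochner_Integration.integral_cong) (auto simp: max_def indicator_def)
    also have "\<dots> = (\<integral>p. max 0 (h (fst p) + run_max h n (snd p)) * indicator A (snd p) \<partial>(M \<Otimes>\<^sub>M S))
       - (\<integral>p. run_max h n (snd p) * indicator A (snd p) \<partial>(M \<Otimes>\<^sub>M S))"
      by (rule Bochner_Integration.integral_diff[OF i2 i1])
    also have "(\<integral>p. run_max h n (snd p) * indicator A (snd p) \<partial>(M \<Otimes>\<^sub>M S)) = (\<integral>\<omega>. run_max h n \<omega> * indicator A \<omega> \<partial>S)"
      by (rule integral_snd) measurable
    finally show ?thesis using 1 by linarith
  qed
  have "J \<longlonglongrightarrow> (\<integral>p. h (fst p) * indicator A (snd p) \<partial>(M \<Otimes>\<^sub>M S))"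
    unfolding J_def
  proof (rule integral_dominated_convergence[where w = "\<lambda>p. \<bar>h (fst p)\<bar>"])
    show "integrable (M \<Otimes>\<^sub>M S) (\<lambda>p. \<bar>h (fst p)\<bar>)" using integrable_fst[OF h] by simp
    show "AE p in M \<Otimes>\<^sub>M S. (\<lambda>n. max (- run_max h n (snd p)) (h (fst p)) * indicator A (snd p))
             \<longlonglongrightarrow> h (fst p) * indicator A (snd p)"
    proof (rule AE_I2)
      fix p
      show "(\<lambda>n. max (- run_max h n (snd p)) (h (fst p)) * indicator A (snd p))
             \<longlonglongrightarrow> h (fst p) * indicator A (snd p)"
      proof (cases "snd p \<in> A")
        case True
        obtain B :: nat where B: "\<bar>h (fst p)\<bar> \<le> real B" using real_arch_simple by blast
        obtain N where N: "real B < run_max h N (snd p)" using True by (auto simp: A_def)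
        have "\<forall>\<^sub>F n in sequentially. max (- run_max h n (snd p)) (h (fst p)) = h (fst p)"
        proof (rule eventually_sequentiallyI[of N])
          fix n assume "N \<le> n"
          from run_max_mono[OF this, of h "snd p"] N B show "max (- run_max h n (snd p)) (h (fst p)) = h (fst p)"
            by (auto simp: max_def)
        qed
        then show ?thesis using True by (intro tendsto_mult_right tendsto_eventually) auto
      qed simp
    qed
    show "AE p in M \<Otimes>\<^sub>M S. norm (max (- run_max h n (snd p)) (h (fst p)) * indicator A (snd p)) \<le> \<bar>h (fst p)\<bar>" for n
      using run_max_nonneg[of h n] by (intro AE_I2) (auto simp: indicator_def max_def split: if_splits)
  qed measurable
  then have "0 \<le> (\<integral>p. h (fst p) * indicator A (snd p) \<partial>(M \<Otimes>\<^sub>M S))"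
    using J_nonneg by (intro LIMSEQ_le_const) auto
  also have "\<dots> = (\<integral>z. (\<integral>\<omega>. h z * indicator A \<omega> \<partial>S) \<partial>M)"
  proof -
    have "integrable (M \<Otimes>\<^sub>M S) (\<lambda>p. h (fst p) * indicator A (snd p))"
      by (rule Bochner_Integration.integrable_bound[OF integrable_fst[OF h]]) (auto simp: indicator_def)
    from R.integral_fst'[OF this] show ?thesis by simp
  qed
  also have "\<dots> = (\<integral>z. h z \<partial>M) * measure S A"
    by simp
  finally have "measure S A = 0"
    using neg by (smt (verit) measure_nonneg mult_neg_pos)
  then have "AE \<omega> in S. \<omega> \<notin> A"
    by (intro AE_not_in) (auto simp: null_sets_def emeasure_eq_measure)
  then show ?thesis
    by (rule AE_mp) (auto simp: A_def not_less)
qed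

lemma AE_eventually_mean_less:
  assumes h: "integrable M h" and e: "(\<integral>x. h x \<partial>M) < e"
  shows "AE \<omega> in S. \<forall>\<^sub>F n in sequentially. (\<Sum>i<n. h (\<omega> i)) / real n < e"
proof -
  define e' where "e' = ((\<integral>x. h x \<partial>M) + e) / 2"
  have e': "(\<integral>x. h x \<partial>M) < e'" "e' < e" using e by (auto simp: e'_def)
  have "AE \<omega> in S. \<exists>B::nat. \<forall>n. run_max (\<lambda>x. h x - e') n \<omega> \<le> real B"
    using h e' by (intro AE_run_max_bounded) (auto simp: M.prob_space)
  then show ?thesis
  proof (rule AE_mp, intro AE_I2 impI)
    fix \<omega> assume "\<exists>B::nat. \<forall>n. run_max (\<lambda>x. h x - e') n \<omega> \<le> real B"
    then obtain B :: nat where B: "\<And>n. run_max (\<lambda>x. h x - e') n \<omega> \<le> real B" by blast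
    have bd: "(\<Sum>i<n. h (\<omega> i)) \<le> real B + real n * e'" for n
      using sum_le_run_max[of "\<lambda>x. h x - e'" \<omega> n] B[of n] by (simp add: sum_subtractf)
    obtain N :: nat where N: "real B / (e - e') < real N" using reals_Archimedean2 by blast
    show "\<forall>\<^sub>F n in sequentially. (\<Sum>i<n. h (\<omega> i)) / real n < e"
    proof (rule eventually_sequentiallyI[of "Suc N"])
      fix n assume n: "Suc N \<le> n"
      then have "real B / (e - e') < real n" using N by linarith
      then have "real B < real n * (e - e')" using e' by (simp add: field_simps)
      then have "real B + real n * e' < real n * e" by (simp add: algebra_simps)
      with bd[of n] n show "(\<Sum>i<n. h (\<omega> i)) / real n < e" by (simp add: field_simps)
    qed
  qed
qed

lemma strong_law:
  assumes h: "integrable M h"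
  shows "AE \<omega> in S. (\<lambda>n. (\<Sum>i<n. h (\<omega> i)) / real n) \<longlonglongrightarrow> (\<integral>x. h x \<partial>M)"
proof -
  let ?m = "\<integral>x. h x \<partial>M"
  have "AE \<omega> in S. \<forall>k. \<forall>\<^sub>F n in sequentially. (\<Sum>i<n. h (\<omega> i)) / real n < ?m + 1 / real (Suc k)"
    unfolding AE_all_countable by (intro allI AE_eventually_mean_less h) simp
  moreover have "AE \<omega> in S. \<forall>k. \<forall>\<^sub>F n in sequentially. (\<Sum>i<n. - h (\<omega> i)) / real n < - ?m + 1 / real (Suc k)"
    unfolding AE_all_countable using h by (intro allI AE_eventually_mean_less) auto
  ultimately show ?thesis
  proof (eventually_elim, intro tendstoI)
    fix \<omega> and r :: real
    assume 1: "\<forall>k. \<forall>\<^sub>F n in sequentially. (\<Sum>i<n. h (\<omega> i)) / real n < ?m + 1 / real (Suc k)"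
      and 2: "\<forall>k. \<forall>\<^sub>F n in sequentially. (\<Sum>i<n. - h (\<omega> i)) / real n < - ?m + 1 / real (Suc k)"
      and r: "0 < r"
    obtain k where k: "1 / real (Suc k) < r" using nat_approx_posE[OF r] by blast
    from 1[rule_format, of k] 2[rule_format, of k]
    show "\<forall>\<^sub>F n in sequentially. dist ((\<Sum>i<n. h (\<omega> i)) / real n) ?m < r"
    proof eventually_elim
      case (elim n)
      have "(\<Sum>i<n. - h (\<omega> i)) / real n = - ((\<Sum>i<n. h (\<omega> i)) / real n)" by (simp add: sum_negf)
      with elim k show ?case unfolding dist_real_def by linarith
    qed
  qed
qed

end

lemma (in prob_space) iid_strong_law:
  fixes V :: "nat \<Rightarrow> 'a \<Rightarrow> 'b" and h :: "'b \<Rightarrow> real"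
  assumes indep: "indep_vars (\<lambda>_. N) V UNIV"
    and same: "\<And>i. distr M N (V i) = distr M N (V 0)"
    and h [measurable]: "h \<in> borel_measurable N" and int: "integrable M (\<lambda>w. h (V 0 w))"
  shows "AE w in M. (\<lambda>n. (\<Sum>i<n. h (V i w)) / real n) \<longlonglongrightarrow> (\<integral>w. h (V 0 w) \<partial>M)"
proof -
  let ?D = "distr M N (V 0)"
  have V [measurable]: "V i \<in> M \<rightarrow>\<^sub>M N" for i using indep by (auto simp: indep_vars_def)
  interpret D: prob_space ?D by (rule prob_space_distr) simp
  interpret S: sequence_space ?D by unfold_locales
  have eq: "distr M (PiM UNIV (\<lambda>_. N)) (\<lambda>w i. V i w) = PiM UNIV (\<lambda>_. ?D)"
    using indep indep_vars_iff_distr_eq_PiM[of "UNIV :: nat set" V "\<lambda>_. N"]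
    by (simp add: restrict_def) (rule PiM_cong, auto intro: same)
  have "AE \<omega> in PiM UNIV (\<lambda>_. ?D). (\<lambda>n. (\<Sum>i<n. h (\<omega> i)) / real n) \<longlonglongrightarrow> (\<integral>x. h x \<partial>?D)"
    using int by (intro S.strong_law) (simp add: integrable_distr_eq)
  then have "AE \<omega> in distr M (PiM UNIV (\<lambda>_. N)) (\<lambda>w i. V i w).
      (\<lambda>n. (\<Sum>i<n. h (\<omega> i)) / real n) \<longlonglongrightarrow> (\<integral>w. h (V 0 w) \<partial>M)"
    unfolding eq by (simp add: integral_distr)
  then show ?thesis
    by (rule AE_distrD[rotated]) (rule measurable_PiM_single', auto intro: measurable_space[OF V])
qed

section \<open>The Cox model with measurement error\<close>

context prob_space
begin

text \<open>The library notion \<open>indep_var\<close> only relates random variables of the same type, so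
  independence is expressed by the joint distribution.\<close>

definition indep_pair :: "'b measure \<Rightarrow> ('a \<Rightarrow> 'b) \<Rightarrow> 'c measure \<Rightarrow> ('a \<Rightarrow> 'c) \<Rightarrow> bool" where
  "indep_pair S A N B \<longleftrightarrow> A \<in> M \<rightarrow>\<^sub>M S \<and> B \<in> M \<rightarrow>\<^sub>M N
    \<and> distr M (S \<Otimes>\<^sub>M N) (\<lambda>w. (A w, B w)) = distr M S A \<Otimes>\<^sub>M distr M N B"

lemma indep_pairI:
  assumes [measurable]: "A \<in> M \<rightarrow>\<^sub>M S" "B \<in> M \<rightarrow>\<^sub>M N"
    and eq: "\<And>E F. E \<in> sets S \<Longrightarrow> F \<in> sets N \<Longrightarrow>
      prob {w \<in> space M. A w \<in> E \<and> B w \<in> F} = prob {w \<in> space M. A w \<in> E} * prob {w \<in> space M. B w \<in> F}"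
  shows "indep_pair S A N B"
proof -
  interpret PA: prob_space "distr M S A" by (rule prob_space_distr) simp
  interpret PB: prob_space "distr M N B" by (rule prob_space_distr) simp
  have "distr M S A \<Otimes>\<^sub>M distr M N B = distr M (S \<Otimes>\<^sub>M N) (\<lambda>w. (A w, B w))"
  proof (rule pair_measure_eqI)
    show "sigma_finite_measure (distr M S A)" "sigma_finite_measure (distr M N B)" ..
    fix E F assume "E \<in> sets (distr M S A)" "F \<in> sets (distr M N B)"
    then have [measurable]: "E \<in> sets S" "F \<in> sets N" by auto
    have "(\<lambda>w. (A w, B w)) -` (E \<times> F) \<inter> space M = {w \<in> space M. A w \<in> E \<and> B w \<in> F}"
      "A -` E \<inter> space M = {w \<in> space M. A w \<in> E}" "B -` F \<inter> space M = {w \<in> space M. B w \<in> F}"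
      by auto
    then show "emeasure (distr M S A) E * emeasure (distr M N B) F
        = emeasure (distr M (S \<Otimes>\<^sub>M N) (\<lambda>w. (A w, B w))) (E \<times> F)"
      using eq[of E F] by (simp add: emeasure_distr emeasure_eq_measure ennreal_mult'[symmetric])
  qed (simp cong: sets_pair_measure_cong)
  then show ?thesis unfolding indep_pair_def by simp
qed

lemma nn_integral_indep_pair:
  assumes ind: "indep_pair S A N B" and g [measurable]: "g \<in> borel_measurable (S \<Otimes>\<^sub>M N)"
  shows "(\<integral>\<^sup>+w. g (A w, B w) \<partial>M) = (\<integral>\<^sup>+w2. (\<integral>\<^sup>+w1. g (A w1, B w2) \<partial>M) \<partial>M)"
proof -
  have [measurable]: "A \<in> M \<rightarrow>\<^sub>M S" "B \<in> M \<rightarrow>\<^sub>M N"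
    and eq: "distr M (S \<Otimes>\<^sub>M N) (\<lambda>x. (A x, B x)) = distr M S A \<Otimes>\<^sub>M distr M N B"
    using ind by (auto simp: indep_pair_def)
  interpret PA: prob_space "distr M S A" by (rule prob_space_distr) simp
  interpret PB: prob_space "distr M N B" by (rule prob_space_distr) simp
  interpret PP: pair_prob_space "distr M S A" "distr M N B" ..
  have "(\<integral>\<^sup>+w. g (A w, B w) \<partial>M) = (\<integral>\<^sup>+p. g p \<partial>distr M (S \<Otimes>\<^sub>M N) (\<lambda>x. (A x, B x)))"
    by (simp add: nn_integral_distr)
  also have "\<dots> = (\<integral>\<^sup>+b. (\<integral>\<^sup>+a. g (a, b) \<partial>distr M S A) \<partial>distr M N B)"
    unfolding eq by (rule PP.nn_integral_snd[symmetric]) simp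
  also have "\<dots> = (\<integral>\<^sup>+w2. (\<integral>\<^sup>+a. g (a, B w2) \<partial>distr M S A) \<partial>M)"
    by (rule nn_integral_distr) measurable
  also have "\<dots> = (\<integral>\<^sup>+w2. (\<integral>\<^sup>+w1. g (A w1, B w2) \<partial>M) \<partial>M)"
    by (intro nn_integral_cong nn_integral_distr)
       (auto intro!: measurable_compose[OF _ g] measurable_Pair1' measurable_space[of B M N])
  finally show ?thesis .
qed

lemma indep_var_of_indep_pair:
  assumes ind: "indep_pair S A N B"
    and [measurable]: "f \<in> borel_measurable S" "g \<in> borel_measurable N"
  shows "indep_var borel (\<lambda>w. f (A w) :: real) borel (\<lambda>w. g (B w))"
proof -
  have [measurable]: "A \<in> M \<rightarrow>\<^sub>M S" "B \<in> M \<rightarrow>\<^sub>M N"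
    and eq: "distr M (S \<Otimes>\<^sub>M N) (\<lambda>x. (A x, B x)) = distr M S A \<Otimes>\<^sub>M distr M N B"
    using ind by (auto simp: indep_pair_def)
  interpret PB: prob_space "distr (distr M N B) borel g"
    by (intro prob_space.prob_space_distr prob_space_distr) simp_all
  have "distr M borel (\<lambda>w. f (A w)) \<Otimes>\<^sub>M distr M borel (\<lambda>w. g (B w))
     = distr (distr M S A) borel f \<Otimes>\<^sub>M distr (distr M N B) borel g"
    by (simp add: distr_distr comp_def)
  also have "\<dots> = distr (distr M S A \<Otimes>\<^sub>M distr M N B) (borel \<Otimes>\<^sub>M borel) (\<lambda>(x, y). (f x, g y))"
    by (rule pair_measure_distr) (simp_all add: PB.sigma_finite_measure_axioms)
  also have "\<dots> = distr M (borel \<Otimes>\<^sub>M borel) (\<lambda>w. (f (A w), g (B w)))"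
    unfolding eq[symmetric] by (simp add: distr_distr comp_def)
  finally show ?thesis by (simp add: indep_var_distribution_eq)
qed

lemma integral_indep_pair_mult:
  assumes ind: "indep_pair S A N B"
    and meas: "f \<in> borel_measurable S" "g \<in> borel_measurable N"
    and int: "integrable M (\<lambda>w. f (A w) :: real)" "integrable M (\<lambda>w. g (B w))"
  shows "(\<integral>w. f (A w) * g (B w) \<partial>M) = (\<integral>w. f (A w) \<partial>M) * (\<integral>w. g (B w) \<partial>M)"
    and "integrable M (\<lambda>w. f (A w) * g (B w))"
  using indep_var_lebesgue_integral[OF indep_var_of_indep_pair[OF ind meas] int]
    indep_var_integrable[OF indep_var_of_indep_pair[OF ind meas] int] by auto

lemma integral_pos:
  assumes "integrable M f" "\<And>w. (0::real) < f w" shows "0 < (\<integral>w. f w \<partial>M)"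
proof -
  have "(\<integral>w. f w \<partial>M) \<noteq> 0"
  proof
    assume "(\<integral>w. f w \<partial>M) = 0"
    then have "AE w in M. f w = 0"
      using integral_nonneg_eq_0_iff_AE[OF assms(1)] assms(2) by (simp add: less_imp_le)
    then have "AE w in M. False" using assms(2) by (auto elim!: eventually_mono simp: less_le)
    then show False using emeasure_space_1 by (simp add: AE_False)
  qed
  moreover have "0 \<le> (\<integral>w. f w \<partial>M)" using assms(2) by (simp add: less_imp_le)
  ultimately show ?thesis by simp
qed

lemma AE_prob_pos_obtain:
  assumes "AE w in M. P w" "0 < prob A" "A \<in> events"
  obtains w where "w \<in> A" "P w"
proof -
  have "\<exists>w\<in>A. P w"
  proof (rule ccontr)
    assume n: "\<not> (\<exists>w\<in>A. P w)"
    have "AE w in M. w \<notin> A" using assms(1) by eventually_elim (use n in auto)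
    then have "prob A = 0" using assms(3) by (simp add: AE_iff_measurable[OF _ refl] measure_eq_emeasure_eq_ennreal
       prob_eq_0)
    with assms(2) show False by simp
  qed
  with that show thesis by blast
qed

end

lemma borel_measurable_integral_atLeast0 [measurable]:
  fixes f :: "real \<Rightarrow> real"
  assumes f: "continuous_on UNIV f"
  shows "(\<lambda>y. integral {0..y} f) \<in> borel_measurable borel"
proof -
  have [measurable]: "f \<in> borel_measurable borel" by (rule borel_measurable_continuous_onI[OF f])
  have "set_integrable lborel {0..y} f" for y
    unfolding set_integrable_def
    by (rule borel_integrable_compact) (auto intro: continuous_on_subset[OF f])
  then have "integral {0..y} f = (\<integral>u. indicator {0..y} u *\<^sub>R f u \<partial>lborel)" for y
    by (simp add: set_borel_integral_eq_integral(2)[symmetric] set_lebesgue_integral_def)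
  then show ?thesis
    by (simp add: indicator_def)
qed

lemma nn_integral_has_integral_Icc:
  fixes f :: "real \<Rightarrow> real"
  assumes [measurable]: "f \<in> borel_measurable borel" and nonneg: "\<And>u. 0 \<le> f u"
    and "(f has_integral I) {a..b}"
  shows "(\<integral>\<^sup>+u. ennreal (f u) * indicator {a..b} u \<partial>lborel) = ennreal I"
proof -
  have "((\<lambda>u. if u \<in> {a..b} then f u else 0) has_integral I) UNIV"
    using assms by (simp only: has_integral_restrict_UNIV)
  also have "(\<lambda>u. if u \<in> {a..b} then f u else 0) = (\<lambda>u. f u * indicator {a..b} u)"
    by auto
  finally have "((\<lambda>u. f u * indicator {a..b} u) has_integral I) UNIV" .
  from nn_integral_has_integral_lborel[OF _ _ this] nonneg show ?thesis
    by (simp add: ennreal_mult' ennreal_indicator)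
qed

lemma nn_integral_Icc_eq_integral:
  fixes f :: "real \<Rightarrow> real"
  assumes f: "continuous_on UNIV f" and nonneg: "\<And>u. 0 \<le> f u"
  shows "(\<integral>\<^sup>+u. ennreal (f u) * indicator {0..y} u \<partial>lborel) = ennreal (integral {0..y} f)"
  by (intro nn_integral_has_integral_Icc nonneg borel_measurable_continuous_onI[OF f]
      integrable_integral integrable_continuous_real continuous_on_subset[OF f]) auto

lemma measurable_indicator_interval [measurable (raw)]:
  fixes f g :: "'a \<Rightarrow> real"
  assumes [measurable]: "f \<in> borel_measurable M" "g \<in> borel_measurable M"
  shows "(\<lambda>x. indicator {..<g x} (f x) :: ennreal) \<in> borel_measurable M"
    "(\<lambda>x. indicator {..g x} (f x) :: ennreal) \<in> borel_measurable M"
  unfolding indicator_def lessThan_iff atMost_iff by measurable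

lemma integral_0_bounds:
  fixes l :: "real \<Rightarrow> real"
  assumes l: "continuous_on UNIV l" "\<And>t. 0 \<le> l t" "\<And>t. l t \<le> R" and y: "0 \<le> y" "y \<le> tau"
  shows "0 \<le> integral {0..y} l" "integral {0..y} l \<le> R * tau"
proof -
  have i: "l integrable_on {0..y}" by (intro integrable_continuous_real continuous_on_subset[OF l(1)]) auto
  show "0 \<le> integral {0..y} l" using i l by (intro integral_nonneg) auto
  have "integral {0..y} l \<le> integral {0..y} (\<lambda>_. R)" using i l by (intro integral_le) auto
  also have "\<dots> = R * y" using y by simp
  also have "\<dots> \<le> R * tau" using y l(2)[of 0] l(3)[of 0] by (intro mult_left_mono) auto
  finally show "integral {0..y} l \<le> R * tau" .
qed

locale cox_model = prob_space M for M :: "'a measure" +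
  fixes X U :: "'a \<Rightarrow> real^'m" and T C :: "'a \<Rightarrow> real"
    and l0 :: "real \<Rightarrow> real" and b0 :: "real^'m" and tau lo hi D :: real
  assumes meas [measurable]: "X \<in> borel_measurable M" "U \<in> borel_measurable M"
      "T \<in> borel_measurable M" "C \<in> borel_measurable M"
    and indep3: "\<And>(A :: (real \<times> (real^'m)) set) (B :: real set) (E :: (real^'m) set).
       A \<in> sets borel \<Longrightarrow> B \<in> sets borel \<Longrightarrow> E \<in> sets borel \<Longrightarrow>
       measure M {w \<in> space M. (T w, X w) \<in> A \<and> C w \<in> B \<and> U w \<in> E}
       = measure M {w \<in> space M. (T w, X w) \<in> A} * measure M {w \<in> space M. C w \<in> B}
         * measure M {w \<in> space M. U w \<in> E}"
    and cox: "\<And>A t. A \<in> sets borel \<Longrightarrow> t \<in> {0..tau} \<Longrightarrow>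
       measure M {w \<in> space M. X w \<in> A \<and> T w > t}
       = integral\<^sup>L M (\<lambda>w. indicator A (X w) * exp (- exp (b0 \<bullet> X w) * integral {0..t} l0))"
    and tau_pos: "0 < tau"
    and C_range: "\<And>w. w \<in> space M \<Longrightarrow> 0 \<le> C w \<and> C w \<le> tau"
    and U_mean: "integral\<^sup>L M U = 0"
    and D_pos: "0 < D" and norm_b0: "norm b0 < D"
    and U_mom: "integrable M (\<lambda>w. exp (D * norm (U w)))"
    and X_mom: "integrable M (\<lambda>w. exp (D * norm (X w)))"
    and C_pos: "\<And>e. e > 0 \<Longrightarrow> measure M {w \<in> space M. C w > tau - e} > 0"
    and cov_pd: "pos_def_matrix (cov_matrix M X)"
    and l0_cont: "continuous_on UNIV l0"
    and lo_pos: "0 < lo" and l0_lower: "\<And>t. lo \<le> l0 t" and l0_upper: "\<And>t. l0 t \<le> hi"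
begin

lemma l0_pos: "0 < l0 t"
  using lo_pos l0_lower[of t] by linarith

lemma borel_l0 [measurable]: "l0 \<in> borel_measurable borel"
  by (rule borel_measurable_continuous_onI[OF l0_cont])

subsection \<open>Independence\<close>

lemma indep_TX_C: "indep_pair borel (\<lambda>w. (T w, X w)) borel C"
proof (rule indep_pairI)
  fix A :: "(real \<times> (real^'m)) set" and B :: "real set"
  assume "A \<in> sets borel" "B \<in> sets borel"
  then show "prob {w \<in> space M. (T w, X w) \<in> A \<and> C w \<in> B}
       = prob {w \<in> space M. (T w, X w) \<in> A} * prob {w \<in> space M. C w \<in> B}"
    using indep3[of A B UNIV] by (simp add: prob_space)
qed simp_all

lemma indep_TXC_U: "indep_pair (borel \<Otimes>\<^sub>M borel) (\<lambda>w. ((T w, X w), C w)) borel U"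
proof -
  let ?V = "\<lambda>w. ((T w, X w), C w)"
  let ?R = "{a \<times> b |a b. a \<in> sets (borel :: (real \<times> (real^'m)) measure) \<and> b \<in> sets (borel :: real measure)}"
  let ?A = "{?V -` E \<inter> space M |E. E \<in> ?R}"
  let ?B = "{U -` E \<inter> space M |E. E \<in> sets borel}"
  have "indep_set ?A ?B"
    unfolding indep_set_def
  proof (rule indep_setsI, goal_cases)
    case (1 i)
    then show ?case by (auto split: bool.splits)
  next
    case (2 A J)
    have core: "prob (a \<inter> b) = prob a * prob b" if "a \<in> ?A" "b \<in> ?B" for a b
    proof -
      from that obtain A B E where [measurable]: "A \<in> sets borel" "B \<in> sets borel" "E \<in> sets borel"
        and a: "a = ?V -` (A \<times> B) \<inter> space M" and b: "b = U -` E \<inter> space M"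
        by blast
      have "prob {w \<in> space M. (T w, X w) \<in> A \<and> C w \<in> B \<and> U w \<in> E}
         = prob {w \<in> space M. (T w, X w) \<in> A \<and> C w \<in> B} * prob {w \<in> space M. U w \<in> E}"
        using indep3[of A B E] indep3[of A B UNIV] by (simp add: prob_space)
      then show ?thesis unfolding a b by (simp add: vimage_def Int_def conj_ac)
    qed
    have "J = {True} \<or> J = {False} \<or> J = {True, False}"
      using 2 by (auto simp: UNIV_bool)
    then show ?case
      using 2 core[of "A True" "A False"] by auto
  qed
  moreover have "Int_stable ?A"
  proof (rule Int_stableI)
    fix a b assume "a \<in> ?A" "b \<in> ?A"
    then obtain A B A' B' where s: "A \<in> sets borel" "B \<in> sets borel" "A' \<in> sets borel" "B' \<in> sets borel"
      and a: "a = ?V -` (A \<times> B) \<inter> space M" and b: "b = ?V -` (A' \<times> B') \<inter> space M"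
      by blast
    have "a \<inter> b = ?V -` ((A \<inter> A') \<times> (B \<inter> B')) \<inter> space M" unfolding a b by auto
    then show "a \<inter> b \<in> ?A" using s by blast
  qed
  moreover have "Int_stable ?B"
  proof (rule Int_stableI)
    fix a b assume "a \<in> ?B" "b \<in> ?B"
    then obtain E E' where s: "E \<in> sets borel" "E' \<in> sets borel"
      and a: "a = U -` E \<inter> space M" and b: "b = U -` E' \<inter> space M"
      by blast
    have "a \<inter> b = U -` (E \<inter> E') \<inter> space M" unfolding a b by auto
    then show "a \<inter> b \<in> ?B" using s by blast
  qed
  ultimately have ind: "indep_set (sigma_sets (space M) ?A) (sigma_sets (space M) ?B)"
    by (rule indep_set_sigma_sets)
  have gen: "{?V -` E \<inter> space M |E. E \<in> sets (borel \<Otimes>\<^sub>M borel)} = sigma_sets (space M) ?A"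
    unfolding sets_pair_measure by (subst sigma_sets_vimage_commute) auto
  show ?thesis
  proof (rule indep_pairI)
    fix E :: "((real \<times> (real^'m)) \<times> real) set" and F :: "(real^'m) set"
    assume E: "E \<in> sets (borel \<Otimes>\<^sub>M borel)" and F: "F \<in> sets borel"
    have "?V -` E \<inter> space M \<in> sigma_sets (space M) ?A" unfolding gen[symmetric] using E by blast
    moreover have "U -` F \<inter> space M \<in> sigma_sets (space M) ?B" using F by blast
    ultimately have "prob ((?V -` E \<inter> space M) \<inter> (U -` F \<inter> space M))
       = prob (?V -` E \<inter> space M) * prob (U -` F \<inter> space M)"
      by (rule indep_setD[OF ind])
    moreover have "(?V -` E \<inter> space M) \<inter> (U -` F \<inter> space M) = {w \<in> space M. ?V w \<in> E \<and> U w \<in> F}"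
      "?V -` E \<inter> space M = {w \<in> space M. ?V w \<in> E}" "U -` F \<inter> space M = {w \<in> space M. U w \<in> F}"
      by auto
    ultimately show "prob {w \<in> space M. ?V w \<in> E \<and> U w \<in> F}
        = prob {w \<in> space M. ?V w \<in> E} * prob {w \<in> space M. U w \<in> F}" by simp
  qed simp_all
qed

lemmas indep_TX_C' = indep_TX_C[folded borel_prod]
lemmas indep_TXC_U' = indep_TXC_U[folded borel_prod]

subsection \<open>The compensator of the event indicator\<close>

definition surv :: "real \<Rightarrow> real^'m \<Rightarrow> real" where
  "surv t x = exp (- exp (b0 \<bullet> x) * integral {0..t} l0)"

lemma measurable_surv [measurable (raw)]:
  assumes [measurable]: "f \<in> borel_measurable N" "g \<in> borel_measurable N"
  shows "(\<lambda>w. surv (f w) (g w)) \<in> borel_measurable N"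
  unfolding surv_def
  using measurable_compose[OF assms(1) borel_measurable_integral_atLeast0[OF l0_cont]] by measurable

lemma nn_integral_surv:
  assumes [measurable]: "k \<in> borel_measurable borel" and t: "t \<in> {0..tau}"
  shows "(\<integral>\<^sup>+w. k (X w) * indicator {t<..} (T w) \<partial>M) = (\<integral>\<^sup>+w. k (X w) * ennreal (surv t (X w)) \<partial>M)"
proof -
  let ?f = "\<lambda>w. indicator {t<..} (T w) :: ennreal" and ?g = "\<lambda>w. ennreal (surv t (X w))"
  have "distr (density M ?f) borel X = distr (density M ?g) borel X"
  proof (rule measure_eqI)
    fix A assume "A \<in> sets (distr (density M ?f) borel X)"
    then have A [measurable]: "A \<in> sets borel" by simp
    have "emeasure (distr (density M ?f) borel X) A = (\<integral>\<^sup>+w. ?f w * indicator (X -` A \<inter> space M) w \<partial>M)"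
      by (simp add: emeasure_distr emeasure_density)
    also have "\<dots> = (\<integral>\<^sup>+w. indicator {w \<in> space M. X w \<in> A \<and> T w > t} w \<partial>M)"
      by (rule nn_integral_cong) (auto simp: indicator_def)
    also have "\<dots> = ennreal (measure M {w \<in> space M. X w \<in> A \<and> T w > t})"
      by (simp add: emeasure_eq_measure)
    also have "\<dots> = ennreal (\<integral>w. indicator A (X w) * surv t (X w) \<partial>M)"
      using cox[OF A t] by (simp add: surv_def)
    also have "\<dots> = (\<integral>\<^sup>+w. ennreal (indicator A (X w) * surv t (X w)) \<partial>M)"
    proof (rule nn_integral_eq_integral[symmetric])
      have "0 \<le> integral {0..t} l0" using l0_pos by (intro integral_nonneg integrable_continuous_real) 
        (auto intro: continuous_on_subset[OF l0_cont] less_imp_le)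
      then have "surv t x \<le> 1" for x by (simp add: surv_def)
      then show "integrable M (\<lambda>w. indicator A (X w) * surv t (X w))"
        by (intro integrable_const_bound[where B=1]) (auto simp: indicator_def surv_def)
    qed (auto simp: surv_def)
    also have "\<dots> = (\<integral>\<^sup>+w. ?g w * indicator (X -` A \<inter> space M) w \<partial>M)"
      by (rule nn_integral_cong) (auto simp: indicator_def)
    also have "\<dots> = emeasure (distr (density M ?g) borel X) A"
      by (simp add: emeasure_distr emeasure_density)
    finally show "emeasure (distr (density M ?f) borel X) A = emeasure (distr (density M ?g) borel X) A" .
  qed simp
  then have "(\<integral>\<^sup>+x. k x \<partial>distr (density M ?f) borel X) = (\<integral>\<^sup>+x. k x \<partial>distr (density M ?g) borel X)"
    by simp
  then show ?thesis
    by (simp add: nn_integral_distr nn_integral_density mult.commute)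
qed

lemma AE_T_pos: "AE w in M. 0 < T w"
proof -
  have "prob {w \<in> space M. 0 < T w} = 1"
    using cox[of UNIV 0] tau_pos by (simp add: prob_space)
  then show ?thesis by (subst (asm) prob_Collect_eq_1) auto
qed

lemma has_derivative_surv:
  assumes "0 \<le> u"
  shows "((\<lambda>t. - surv t x) has_real_derivative l0 u * exp (b0 \<bullet> x) * surv u x) (at u within {0..})"
proof -
  have "((\<lambda>t. integral {0..t} l0) has_real_derivative l0 u) (at u within {0..u+1})"
    using assms by (intro integral_has_real_derivative) (auto intro: continuous_on_subset[OF l0_cont])
  moreover have "at u within {0..u+1} = at u within {0..}"
    by (rule at_within_nhd[of _ "{..<u+1}"]) auto
  ultimately have "((\<lambda>t. integral {0..t} l0) has_real_derivative l0 u) (at u within {0..})"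
    by simp
  then show ?thesis unfolding surv_def
    by (auto intro!: derivative_eq_intros)
qed

lemma nn_integral_surv_density:
  assumes "0 \<le> a" "a \<le> b"
  shows "(\<integral>\<^sup>+u. ennreal (l0 u * exp (b0 \<bullet> x) * surv u x) * indicator {a..b} u \<partial>lborel)
    = ennreal (surv a x - surv b x)"
proof (rule nn_integral_has_integral_Icc)
  have "((\<lambda>u. l0 u * exp (b0 \<bullet> x) * surv u x) has_integral (- surv b x - (- surv a x))) {a..b}"
  proof (rule fundamental_theorem_of_calculus)
    fix u assume "u \<in> {a..b}"
    then show "((\<lambda>t. - surv t x) has_vector_derivative l0 u * exp (b0 \<bullet> x) * surv u x) (at u within {a..b})"
      unfolding has_real_derivative_iff_has_vector_derivative[symmetric]
      by (intro has_field_derivative_subset[OF has_derivative_surv]) (use assms in auto)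
  qed (rule assms)
  then show "((\<lambda>u. l0 u * exp (b0 \<bullet> x) * surv u x) has_integral (surv a x - surv b x)) {a..b}"
    by simp
  show "0 \<le> l0 u * exp (b0 \<bullet> x) * surv u x" for u using l0_pos[of u] by (simp add: surv_def)
qed simp

lemma nn_integral_T:
  assumes k [measurable]: "k \<in> borel_measurable borel" and fin: "(\<integral>\<^sup>+w. k (X w) \<partial>M) < \<infinity>"
    and F [measurable]: "F \<in> borel_measurable borel"
  shows "(\<integral>\<^sup>+w. k (X w) * indicator {..tau} (T w) * F (T w) \<partial>M)
    = (\<integral>\<^sup>+u. (\<integral>\<^sup>+w. k (X w) * ennreal (l0 u * exp (b0 \<bullet> X w) * surv u (X w)) * indicator {0..tau} u \<partial>M) * F u \<partial>lborel)"
proof -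
  let ?f = "\<lambda>w. k (X w) * indicator {..tau} (T w)"
  let ?p = "\<lambda>u. \<integral>\<^sup>+w. k (X w) * ennreal (l0 u * exp (b0 \<bullet> X w) * surv u (X w)) * indicator {0..tau} u \<partial>M"
  have p [measurable]: "?p \<in> borel_measurable borel" by measurable
  have "distr (density M ?f) borel T = density lborel ?p"
  proof (rule measure_eqI_lessThan)
    fix x :: real
    have L: "emeasure (distr (density M ?f) borel T) {x<..}
        = (\<integral>\<^sup>+w. k (X w) * indicator {..tau} (T w) * indicator {x<..} (T w) \<partial>M)"
      by (subst emeasure_distr) (auto simp: emeasure_density indicator_def intro!: nn_integral_cong)
    also have "\<dots> \<le> (\<integral>\<^sup>+w. k (X w) \<partial>M)"
      by (rule nn_integral_mono) (auto simp: indicator_def)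
    finally show "emeasure (distr (density M ?f) borel T) {x<..} < \<infinity>" using fin by auto
    interpret MM: pair_sigma_finite lborel M by unfold_locales
    have R: "emeasure (density lborel ?p) {x<..} = (\<integral>\<^sup>+u. ?p u * indicator {x<..} u \<partial>lborel)"
      by (rule emeasure_density) auto
    also have "\<dots> = (\<integral>\<^sup>+u. (\<integral>\<^sup>+w. k (X w) * ennreal (l0 u * exp (b0 \<bullet> X w) * surv u (X w)) * indicator ({0..tau} \<inter> {x<..}) u \<partial>M) \<partial>lborel)"
      by (subst nn_integral_multc[symmetric]) (auto intro!: nn_integral_cong simp: indicator_def)
    also have "\<dots> = (\<integral>\<^sup>+w. (\<integral>\<^sup>+u. k (X w) * ennreal (l0 u * exp (b0 \<bullet> X w) * surv u (X w)) * indicator ({0..tau} \<inter> {x<..}) u \<partial>lborel) \<partial>M)"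
      by (rule MM.Fubini'[symmetric]) measurable
    also have "\<dots> = (\<integral>\<^sup>+w. k (X w) * (\<integral>\<^sup>+u. ennreal (l0 u * exp (b0 \<bullet> X w) * surv u (X w)) * indicator ({0..tau} \<inter> {x<..}) u \<partial>lborel) \<partial>M)"
      by (subst nn_integral_cmult[symmetric]) (auto simp: mult.assoc)
    finally have R: "emeasure (density lborel ?p) {x<..} = \<dots>" .
    show "emeasure (distr (density M ?f) borel T) {x<..} = emeasure (density lborel ?p) {x<..}"
    proof (cases "x < tau")
      case False
      have "(\<integral>\<^sup>+w. k (X w) * indicator {..tau} (T w) * indicator {x<..} (T w) \<partial>M) = (\<integral>\<^sup>+w. 0 \<partial>M)"
        using False by (intro nn_integral_cong) (auto simp: indicator_def)
      moreover have "{0..tau} \<inter> {x<..} = {}" using False by auto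
      ultimately show ?thesis unfolding L R by simp
    next
      case True
      define a where "a = max 0 x"
      have a: "0 \<le> a" "a \<le> tau" using True tau_pos by (auto simp: a_def)
      have "(\<integral>\<^sup>+u. ennreal (l0 u * exp (b0 \<bullet> y) * surv u y) * indicator ({0..tau} \<inter> {x<..}) u \<partial>lborel)
         = (\<integral>\<^sup>+u. ennreal (l0 u * exp (b0 \<bullet> y) * surv u y) * indicator {a..tau} u \<partial>lborel)" for y
      proof (rule nn_integral_cong_AE)
        have "AE u in lborel. u \<noteq> x" by (rule AE_lborel_singleton)
        then show "AE u in lborel. ennreal (l0 u * exp (b0 \<bullet> y) * surv u y) * indicator ({0..tau} \<inter> {x<..}) u
           = ennreal (l0 u * exp (b0 \<bullet> y) * surv u y) * indicator {a..tau} u"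
          by eventually_elim (auto simp: a_def indicator_def)
      qed
      then have R': "emeasure (density lborel ?p) {x<..} = (\<integral>\<^sup>+w. k (X w) * ennreal (surv a (X w) - surv tau (X w)) \<partial>M)"
        using a unfolding R by (simp add: nn_integral_surv_density)
      let ?e = "\<integral>\<^sup>+w. k (X w) * ennreal (surv tau (X w)) \<partial>M"
      have surv_dec: "surv tau y \<le> surv a y" for y
        using a l0_pos unfolding surv_def
        by (auto intro!: integral_subset_le integrable_continuous_real intro: continuous_on_subset[OF l0_cont] less_imp_le)
      have "emeasure (density lborel ?p) {x<..} + ?e
        = (\<integral>\<^sup>+w. k (X w) * ennreal (surv a (X w) - surv tau (X w)) + k (X w) * ennreal (surv tau (X w)) \<partial>M)"
        unfolding R' by (rule nn_integral_add[symmetric]) measurable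
      also have "\<dots> = (\<integral>\<^sup>+w. k (X w) * ennreal (surv a (X w)) \<partial>M)"
        using surv_dec
        by (intro nn_integral_cong)
           (auto simp: distrib_left[symmetric] ennreal_plus[symmetric] surv_def simp del: ennreal_plus)
      also have "\<dots> = (\<integral>\<^sup>+w. k (X w) * indicator {a<..} (T w) \<partial>M)"
        using a by (subst nn_integral_surv) auto
      also have "\<dots> = (\<integral>\<^sup>+w. k (X w) * indicator {..tau} (T w) * indicator {x<..} (T w)
           + k (X w) * indicator {tau<..} (T w) \<partial>M)"
      proof (rule nn_integral_cong_AE)
        show "AE w in M. k (X w) * indicator {a<..} (T w) = k (X w) * indicator {..tau} (T w) * indicator {x<..} (T w)
           + k (X w) * indicator {tau<..} (T w)"
          using AE_T_pos
          by eventually_elim (use a True in \<open>auto simp: indicator_def a_def\<close>)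
      qed
      also have "\<dots> = emeasure (distr (density M ?f) borel T) {x<..} + (\<integral>\<^sup>+w. k (X w) * indicator {tau<..} (T w) \<partial>M)"
        unfolding L by (rule nn_integral_add) measurable
      also have "(\<integral>\<^sup>+w. k (X w) * indicator {tau<..} (T w) \<partial>M) = ?e"
        using tau_pos by (subst nn_integral_surv) auto
      finally have eq: "emeasure (density lborel ?p) {x<..} + ?e = emeasure (distr (density M ?f) borel T) {x<..} + ?e" .
      have "?e = (\<integral>\<^sup>+w. k (X w) * indicator {tau<..} (T w) \<partial>M)"
        using tau_pos by (subst nn_integral_surv) auto
      also have "\<dots> \<le> (\<integral>\<^sup>+w. k (X w) \<partial>M)"
        by (rule nn_integral_mono) (auto simp: indicator_def)
      finally have "?e < \<infinity>" using fin by auto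
      then show ?thesis using eq by (auto simp: add.commute[of _ ?e] ennreal_add_left_cancel)
    qed
  qed auto
  then have "(\<integral>\<^sup>+t. F t \<partial>distr (density M ?f) borel T) = (\<integral>\<^sup>+t. F t \<partial>density lborel ?p)" by simp
  then show ?thesis
    by (simp add: nn_integral_distr nn_integral_density)
qed

lemma nn_compensator_T:
  assumes k [measurable]: "k \<in> borel_measurable borel" and fin: "(\<integral>\<^sup>+w. k (X w) \<partial>M) < \<infinity>"
    and F [measurable]: "F \<in> borel_measurable borel"
  shows "(\<integral>\<^sup>+w. k (X w) * indicator {..tau} (T w) * F (T w) \<partial>M)
    = (\<integral>\<^sup>+w. k (X w) * ennreal (exp (b0 \<bullet> X w)) *
         (\<integral>\<^sup>+u. F u * ennreal (l0 u) * indicator {0..tau} u * indicator {..<T w} u \<partial>lborel) \<partial>M)"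
proof -
  interpret MM: pair_sigma_finite lborel M by unfold_locales
  let ?k = "\<lambda>x. k x * ennreal (exp (b0 \<bullet> x))"
  have "(\<integral>\<^sup>+w. k (X w) * ennreal (l0 u * exp (b0 \<bullet> X w) * surv u (X w)) * indicator {0..tau} u \<partial>M) * F u
     = (\<integral>\<^sup>+w. ?k (X w) * (F u * ennreal (l0 u) * indicator {0..tau} u * indicator {..<T w} u) \<partial>M)" for u
  proof (cases "u \<in> {0..tau}")
    case True
    have "(\<integral>\<^sup>+w. k (X w) * ennreal (l0 u * exp (b0 \<bullet> X w) * surv u (X w)) * indicator {0..tau} u \<partial>M) * F u
      = (\<integral>\<^sup>+w. (?k (X w) * ennreal (surv u (X w))) * (ennreal (l0 u) * F u) \<partial>M)"
      using True l0_pos[of u]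
      by (subst nn_integral_multc[symmetric])
         (auto intro!: nn_integral_cong simp: ennreal_mult surv_def mult_ac)
    also have "\<dots> = (\<integral>\<^sup>+w. ?k (X w) * ennreal (surv u (X w)) \<partial>M) * (ennreal (l0 u) * F u)"
      by (rule nn_integral_multc) measurable
    also have "\<dots> = (\<integral>\<^sup>+w. ?k (X w) * indicator {u<..} (T w) \<partial>M) * (ennreal (l0 u) * F u)"
      using True by (subst nn_integral_surv) auto
    also have "\<dots> = (\<integral>\<^sup>+w. (?k (X w) * indicator {u<..} (T w)) * (ennreal (l0 u) * F u) \<partial>M)"
      by (rule nn_integral_multc[symmetric]) measurable
    also have "\<dots> = (\<integral>\<^sup>+w. ?k (X w) * (F u * ennreal (l0 u) * indicator {0..tau} u * indicator {..<T w} u) \<partial>M)"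
      using True by (intro nn_integral_cong) (auto simp: indicator_def mult_ac)
    finally show ?thesis .
  qed simp
  then have "(\<integral>\<^sup>+w. k (X w) * indicator {..tau} (T w) * F (T w) \<partial>M)
     = (\<integral>\<^sup>+u. (\<integral>\<^sup>+w. ?k (X w) * (F u * ennreal (l0 u) * indicator {0..tau} u * indicator {..<T w} u) \<partial>M) \<partial>lborel)"
    using nn_integral_T[OF k fin F] by simp
  also have "\<dots> = (\<integral>\<^sup>+w. (\<integral>\<^sup>+u. ?k (X w) * (F u * ennreal (l0 u) * indicator {0..tau} u * indicator {..<T w} u) \<partial>lborel) \<partial>M)"
    by (rule MM.Fubini'[symmetric]) measurable
  also have "\<dots> = (\<integral>\<^sup>+w. ?k (X w) *
         (\<integral>\<^sup>+u. F u * ennreal (l0 u) * indicator {0..tau} u * indicator {..<T w} u \<partial>lborel) \<partial>M)"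
    by (intro nn_integral_cong nn_integral_cmult) measurable
  finally show ?thesis .
qed

lemma nn_compensator:
  assumes k [measurable]: "k \<in> borel_measurable borel" and fin: "(\<integral>\<^sup>+w. k (X w) \<partial>M) < \<infinity>"
    and f: "continuous_on UNIV f" and nonneg: "\<And>u. 0 \<le> f u"
  shows "(\<integral>\<^sup>+w. k (X w) * indicator {..C w} (T w) * ennreal (f (T w)) \<partial>M)
    = (\<integral>\<^sup>+w. k (X w) * ennreal (exp (b0 \<bullet> X w)) * ennreal (integral {0..min (T w) (C w)} (\<lambda>u. f u * l0 u)) \<partial>M)"
proof -
  have fm [measurable]: "f \<in> borel_measurable borel" by (rule borel_measurable_continuous_onI[OF f])
  have fl: "continuous_on UNIV (\<lambda>u. f u * l0 u)" by (intro continuous_intros f l0_cont)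
  have [measurable]: "(\<lambda>p. integral {0..min (fst (fst p)) (snd p)} (\<lambda>u. f u * l0 u))
      \<in> borel_measurable ((borel \<Otimes>\<^sub>M (borel :: (real^'m) measure)) \<Otimes>\<^sub>M borel)"
    by (rule measurable_compose[OF _ borel_measurable_integral_atLeast0[OF fl]]) simp
  let ?g = "\<lambda>p. k (snd (fst p)) * indicator {..tau} (fst (fst p)) * (indicator {..snd p} (fst (fst p)) * ennreal (f (fst (fst p))))"
  let ?g' = "\<lambda>p. k (snd (fst p)) * ennreal (exp (b0 \<bullet> snd (fst p))) * ennreal (integral {0..min (fst (fst p)) (snd p)} (\<lambda>u. f u * l0 u))"
  have "(\<integral>\<^sup>+w. k (X w) * indicator {..C w} (T w) * ennreal (f (T w)) \<partial>M) = (\<integral>\<^sup>+w. ?g ((T w, X w), C w) \<partial>M)"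
    using C_range by (intro nn_integral_cong) (force simp: indicator_def)
  also have "\<dots> = (\<integral>\<^sup>+w2. (\<integral>\<^sup>+w1. ?g ((T w1, X w1), C w2) \<partial>M) \<partial>M)"
    by (rule nn_integral_indep_pair[OF indep_TX_C']) measurable
  also have "\<dots> = (\<integral>\<^sup>+w2. (\<integral>\<^sup>+w1. ?g' ((T w1, X w1), C w2) \<partial>M) \<partial>M)"
  proof (rule nn_integral_cong)
    fix w2 assume w2: "w2 \<in> space M"
    define c where "c = C w2"
    have c: "0 \<le> c" "c \<le> tau" using C_range[OF w2] by (auto simp: c_def)
    have "(\<integral>\<^sup>+w1. ?g ((T w1, X w1), C w2) \<partial>M)
       = (\<integral>\<^sup>+w. k (X w) * indicator {..tau} (T w) * (indicator {..c} (T w) * ennreal (f (T w))) \<partial>M)"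
      by (simp add: c_def)
    also have "\<dots> = (\<integral>\<^sup>+w. k (X w) * ennreal (exp (b0 \<bullet> X w)) *
         (\<integral>\<^sup>+u. (indicator {..c} u * ennreal (f u)) * ennreal (l0 u) * indicator {0..tau} u * indicator {..<T w} u \<partial>lborel) \<partial>M)"
      by (rule nn_compensator_T[OF k fin]) measurable
    also have "\<dots> = (\<integral>\<^sup>+w. k (X w) * ennreal (exp (b0 \<bullet> X w)) *
         (\<integral>\<^sup>+u. ennreal (f u * l0 u) * indicator {0..min (T w) c} u \<partial>lborel) \<partial>M)"
    proof -
      have "(\<integral>\<^sup>+u. (indicator {..c} u * ennreal (f u)) * ennreal (l0 u) * indicator {0..tau} u * indicator {..<T w} u \<partial>lborel)
        = (\<integral>\<^sup>+u. ennreal (f u * l0 u) * indicator {0..min (T w) c} u \<partial>lborel)" for w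
      proof (rule nn_integral_cong_AE)
        have "AE u in lborel. u \<noteq> T w" by (rule AE_lborel_singleton)
        then show "AE u in lborel. (indicator {..c} u * ennreal (f u)) * ennreal (l0 u) * indicator {0..tau} u * indicator {..<T w} u
        = ennreal (f u * l0 u) * indicator {0..min (T w) c} u"
        by eventually_elim (use c nonneg l0_pos in \<open>auto simp: indicator_def ennreal_mult' less_imp_le\<close>)
      qed
      then show ?thesis by simp
    qed
    also have "\<dots> = (\<integral>\<^sup>+w1. ?g' ((T w1, X w1), C w2) \<partial>M)"
      using nonneg l0_pos by (subst nn_integral_Icc_eq_integral[OF fl]) (auto simp: c_def less_imp_le)
    finally show "(\<integral>\<^sup>+w1. ?g ((T w1, X w1), C w2) \<partial>M) = (\<integral>\<^sup>+w1. ?g' ((T w1, X w1), C w2) \<partial>M)" .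
  qed
  also have "\<dots> = (\<integral>\<^sup>+w. ?g' ((T w, X w), C w) \<partial>M)"
    by (rule nn_integral_indep_pair[OF indep_TX_C', symmetric]) measurable
  finally show ?thesis by simp
qed

lemma compensator:
  fixes k :: "real^'m \<Rightarrow> real"
  assumes k [measurable]: "k \<in> borel_measurable borel" and int: "integrable M (\<lambda>w. k (X w))"
    and k_nonneg: "\<And>x. 0 \<le> k x"
    and f: "continuous_on UNIV f" and nonneg: "\<And>u. 0 \<le> f u"
  shows "(\<integral>w. k (X w) * (of_bool (T w \<le> C w) * f (min (T w) (C w))) \<partial>M)
    = (\<integral>w. k (X w) * exp (b0 \<bullet> X w) * integral {0..min (T w) (C w)} (\<lambda>u. f u * l0 u) \<partial>M)"
proof -
  have fm [measurable]: "f \<in> borel_measurable borel" by (rule borel_measurable_continuous_onI[OF f])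
  have fl: "continuous_on UNIV (\<lambda>u. f u * l0 u)" by (intro continuous_intros f l0_cont)
  have [measurable]: "(\<lambda>w. integral {0..min (T w) (C w)} (\<lambda>u. f u * l0 u)) \<in> borel_measurable M"
    by (rule measurable_compose[OF _ borel_measurable_integral_atLeast0[OF fl]]) simp
  have I: "0 \<le> integral {0..y} (\<lambda>u. f u * l0 u)" for y
    using nonneg l0_pos
    by (intro integral_nonneg integrable_continuous_real continuous_on_subset[OF fl]) (auto simp: less_imp_le)
  have fin: "(\<integral>\<^sup>+w. ennreal (k (X w)) \<partial>M) < \<infinity>"
    using int k_nonneg by (simp add: nn_integral_eq_integral)
  have "(\<integral>w. k (X w) * (of_bool (T w \<le> C w) * f (min (T w) (C w))) \<partial>M)
     = enn2real (\<integral>\<^sup>+w. ennreal (k (X w) * (of_bool (T w \<le> C w) * f (min (T w) (C w)))) \<partial>M)"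
    using k_nonneg nonneg by (intro integral_eq_nn_integral) auto
  also have "(\<integral>\<^sup>+w. ennreal (k (X w) * (of_bool (T w \<le> C w) * f (min (T w) (C w)))) \<partial>M)
      = (\<integral>\<^sup>+w. ennreal (k (X w)) * indicator {..C w} (T w) * ennreal (f (T w)) \<partial>M)"
    using k_nonneg nonneg by (intro nn_integral_cong) (auto simp: indicator_def min_def ennreal_mult)
  also have "\<dots> = (\<integral>\<^sup>+w. ennreal (k (X w)) * ennreal (exp (b0 \<bullet> X w)) * ennreal (integral {0..min (T w) (C w)} (\<lambda>u. f u * l0 u)) \<partial>M)"
    by (rule nn_compensator[OF _ fin f nonneg]) measurable
  also have "\<dots> = (\<integral>\<^sup>+w. ennreal (k (X w) * exp (b0 \<bullet> X w) * integral {0..min (T w) (C w)} (\<lambda>u. f u * l0 u)) \<partial>M)"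
    using k_nonneg I by (intro nn_integral_cong) (auto simp: ennreal_mult)
  also have "enn2real \<dots> = (\<integral>w. k (X w) * exp (b0 \<bullet> X w) * integral {0..min (T w) (C w)} (\<lambda>u. f u * l0 u) \<partial>M)"
    using k_nonneg I by (intro integral_eq_nn_integral[symmetric]) auto
  finally show ?thesis .
qed

subsection \<open>Local upper bounds for the objective function\<close>

definition mgfd :: "real^'m \<Rightarrow> real \<Rightarrow> real" where
  "mgfd b d = (\<integral>w. exp (b \<bullet> U w + d * norm (U w)) \<partial>M)"

lemma inner_add_norm_le:
  fixes b x :: "'v::real_inner"
  assumes "norm b + d \<le> D"
  shows "b \<bullet> x + d * norm x \<le> D * norm x"
proof -
  have "b \<bullet> x + d * norm x \<le> (norm b + d) * norm x"
    using norm_cauchy_schwarz[of b x] by (simp add: algebra_simps)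
  also have "\<dots> \<le> D * norm x" using assms by (intro mult_right_mono) auto
  finally show ?thesis .
qed

lemma integrable_mgfd: "norm b + d \<le> D \<Longrightarrow> integrable M (\<lambda>w. exp (b \<bullet> U w + d * norm (U w)))"
  by (rule Bochner_Integration.integrable_bound[OF U_mom]) (auto intro: inner_add_norm_le)

lemma mgfd_0: "mgfd b 0 = mgf M U b"
  by (simp add: mgfd_def mgf_def)

lemma mgf_pos: "norm b < D \<Longrightarrow> 0 < mgf M U b"
  unfolding mgfd_0[symmetric] mgfd_def by (rule integral_pos[OF integrable_mgfd]) auto

lemma mgf_le_mgfd:
  assumes "norm b + d \<le> D" "norm (b' - b) \<le> d"
  shows "mgf M U b' \<le> mgfd b d"
proof -
  have le: "b' \<bullet> x \<le> b \<bullet> x + d * norm x" for x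
  proof -
    have "(b' - b) \<bullet> x \<le> norm (b' - b) * norm x" by (rule norm_cauchy_schwarz)
    also have "\<dots> \<le> d * norm x" using assms by (intro mult_right_mono) auto
    finally show ?thesis by (simp add: inner_diff_left)
  qed
  have "norm b' \<le> D" using assms norm_triangle_sub[of b' b] by linarith
  then have "integrable M (\<lambda>w. exp (b' \<bullet> U w + 0 * norm (U w)))" by (intro integrable_mgfd) simp
  then show ?thesis
    unfolding mgf_def mgfd_def using assms le by (intro integral_mono integrable_mgfd) auto
qed

lemma mgfd_tendsto:
  assumes d: "d \<longlonglongrightarrow> 0" "\<And>n. norm b + d n \<le> D"
  shows "(\<lambda>n. mgfd b (d n)) \<longlonglongrightarrow> mgf M U b"
  unfolding mgfd_0[symmetric] mgfd_def
proof (rule integral_dominated_convergence[OF _ _ U_mom])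
  show "AE w in M. (\<lambda>n. exp (b \<bullet> U w + d n * norm (U w))) \<longlonglongrightarrow> exp (b \<bullet> U w + 0 * norm (U w))"
    using d(1) by (intro AE_I2 tendsto_intros)
  show "AE w in M. norm (exp (b \<bullet> U w + d n * norm (U w))) \<le> exp (D * norm (U w))" for n
    using d(2)[of n] by (auto intro: inner_add_norm_le)
qed measurable

text \<open>An upper bound for the difference of the contributions of a parameter within distance \<open>d\<close>
  of \<open>(l, b)\<close> and the true parameter.  The logarithm is estimated by \<open>ln r \<le> 2 * (sqrt r - 1)\<close>,
  so that zeros of \<open>l\<close> cause no infinities and the expectation at \<open>d = 0\<close> becomes minus a
  squared Hellinger-type distance.\<close>

definition excess :: "(real \<Rightarrow> real) \<Rightarrow> real^'m \<Rightarrow> real \<Rightarrow> (real^'m) \<times> real \<times> real \<times> (real^'m) \<Rightarrow> real" where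
  "excess l b d = (\<lambda>(x, t, c, u).
     of_bool (t \<le> c) * (2 * (sqrt ((l (min t c) + d) / l0 (min t c)) * exp ((b - b0) \<bullet> x / 2) - 1)
        + (b - b0) \<bullet> u + d * norm (x + u))
     - exp (b \<bullet> (x + u) - d * norm (x + u)) / mgfd b d * max 0 (integral {0..min t c} l - d * min t c)
     + exp (b0 \<bullet> (x + u)) / mgf M U b0 * integral {0..min t c} l0)"

lemma measurable_excess [measurable]:
  assumes l: "continuous_on UNIV l"
  shows "excess l b d \<in> borel_measurable borel"
proof -
  have [measurable]: "l \<in> borel_measurable borel" by (rule borel_measurable_continuous_onI[OF l])
  note [measurable (raw)] = measurable_compose[OF _ borel_measurable_integral_atLeast0[OF l]]
    measurable_compose[OF _ borel_measurable_integral_atLeast0[OF l0_cont]]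
  have "excess l b d \<in> borel_measurable (borel \<Otimes>\<^sub>M borel \<Otimes>\<^sub>M borel \<Otimes>\<^sub>M borel)"
    unfolding excess_def by measurable
  then show ?thesis by (simp add: borel_prod)
qed

definition envelope :: "'a \<Rightarrow> real" where
  "envelope w = exp (D * norm (X w)) * exp (D * norm (U w))"

lemma integrable_envelope: "integrable M envelope"
  unfolding envelope_def
  using integral_indep_pair_mult(2)[OF indep_TXC_U', of "\<lambda>p. exp (D * norm (snd (fst p)))" "\<lambda>u. exp (D * norm u)"]
    X_mom U_mom by simp

lemma exp_D_ge_1: "1 \<le> exp (D * norm x)"
  using D_pos by simp

lemma envelope_ge:
  "1 \<le> envelope w" "exp (D * norm (X w)) \<le> envelope w" "exp (D * norm (U w)) \<le> envelope w"
  "D * norm (X w) \<le> envelope w" "D * norm (U w) \<le> envelope w"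
proof -
  show 1: "exp (D * norm (X w)) \<le> envelope w" "exp (D * norm (U w)) \<le> envelope w"
    using exp_D_ge_1[of "X w"] exp_D_ge_1[of "U w"] unfolding envelope_def
    by (simp_all add: mult_le_cancel_left1 mult_le_cancel_right1)
  show "1 \<le> envelope w" using exp_D_ge_1[of "X w"] 1 by linarith
  show "D * norm (X w) \<le> envelope w" "D * norm (U w) \<le> envelope w"
    using exp_ge_add_one_self[of "D * norm (X w)"] exp_ge_add_one_self[of "D * norm (U w)"] 1 by linarith+
qed

lemma exp_inner_W_le_envelope:
  assumes "norm b \<le> D"
  shows "exp (b \<bullet> (X w + U w)) \<le> envelope w"
proof -
  have "b \<bullet> X w + 0 * norm (X w) \<le> D * norm (X w)" "b \<bullet> U w + 0 * norm (U w) \<le> D * norm (U w)"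
    using assms by (intro inner_add_norm_le; simp)+
  then show ?thesis by (simp add: envelope_def inner_add_right exp_add[symmetric])
qed

lemma AE_Y_range: "AE w in M. 0 \<le> min (T w) (C w) \<and> min (T w) (C w) \<le> tau"
  using AE_T_pos
proof (rule AE_mp, intro AE_I2 impI)
  fix w assume "w \<in> space M" "0 < T w"
  with C_range[of w] show "0 \<le> min (T w) (C w) \<and> min (T w) (C w) \<le> tau" by auto
qed

lemma excess_bound:
  assumes l: "continuous_on UNIV l" "\<And>t. 0 \<le> l t" "\<And>t. l t \<le> R"
    and b: "norm b < D" and d: "0 \<le> d" "norm b + d \<le> D"
    and y: "0 \<le> min (T w) (C w) \<and> min (T w) (C w) \<le> tau"
  shows "\<bar>excess l b d (X w, T w, C w, U w)\<bar>
    \<le> (2 * (sqrt ((R + D) / lo) + 1) + 4 + R * tau / mgf M U b + hi * tau / mgf M U b0) * envelope w"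
proof -
  define y where "y = min (T w) (C w)"
  have y: "0 \<le> y" "y \<le> tau" using y by (auto simp: y_def)
  have R: "0 \<le> R" using l(2)[of 0] l(3)[of 0] by linarith
  define a1 where "a1 = sqrt ((l y + d) / l0 y) * exp ((b - b0) \<bullet> X w / 2)"
  define a2 where "a2 = (b - b0) \<bullet> U w"
  define a3 where "a3 = d * norm (X w + U w)"
  define a4 where "a4 = exp (b \<bullet> (X w + U w) - d * norm (X w + U w)) / mgfd b d * max 0 (integral {0..y} l - d * y)"
  define a5 where "a5 = exp (b0 \<bullet> (X w + U w)) / mgf M U b0 * integral {0..y} l0"
  have dD: "d \<le> D" using d(2) norm_ge_zero[of b] by linarith
  have dom0: "0 \<le> envelope w" using envelope_ge(1)[of w] by linarith
  have nbb: "norm (b - b0) \<le> 2 * D" using norm_triangle_ineq4[of b b0] b norm_b0 by linarith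
  have "0 \<le> a1" using l(2)[of y] d l0_pos[of y] by (simp add: a1_def)
  moreover have "a1 \<le> sqrt ((R + D) / lo) * envelope w"
    unfolding a1_def
  proof (rule mult_mono)
    show "sqrt ((l y + d) / l0 y) \<le> sqrt ((R + D) / lo)"
      using l(2,3)[of y] d dD R l0_lower[of y] lo_pos l0_pos[of y] D_pos
      by (intro real_sqrt_le_mono frac_le) auto
    have "(b - b0) \<bullet> X w \<le> norm (b - b0) * norm (X w)" by (rule norm_cauchy_schwarz)
    also have "\<dots> \<le> 2 * D * norm (X w)" using nbb by (intro mult_right_mono) auto
    finally have "exp ((b - b0) \<bullet> X w / 2) \<le> exp (D * norm (X w))" by simp
    then show "exp ((b - b0) \<bullet> X w / 2) \<le> envelope w" using envelope_ge(2)[of w] by linarith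
    show "0 \<le> sqrt ((R + D) / lo)" using R D_pos lo_pos by simp
  qed auto
  ultimately have a1: "\<bar>a1\<bar> \<le> sqrt ((R + D) / lo) * envelope w" by simp
  have "\<bar>a2\<bar> \<le> norm (b - b0) * norm (U w)" unfolding a2_def by (rule Cauchy_Schwarz_ineq2)
  also have "\<dots> \<le> 2 * D * norm (U w)" using nbb by (intro mult_right_mono) auto
  finally have a2: "\<bar>a2\<bar> \<le> 2 * envelope w" using envelope_ge(5)[of w] by linarith
  have "\<bar>a3\<bar> = d * norm (X w + U w)" using d by (simp add: a3_def)
  also have "\<dots> \<le> D * (norm (X w) + norm (U w))" using dD D_pos d by (intro mult_mono norm_triangle_ineq) auto
  finally have a3: "\<bar>a3\<bar> \<le> 2 * envelope w" using envelope_ge(4,5)[of w] by (simp add: algebra_simps)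
  have m: "0 < mgf M U b" "mgf M U b \<le> mgfd b d" "0 < mgf M U b0"
    using mgf_pos[OF b] mgf_pos[OF norm_b0] mgf_le_mgfd[of b d b] d by auto
  have "0 \<le> a4" using m by (simp add: a4_def)
  moreover have "a4 \<le> envelope w / mgf M U b * (R * tau)"
    unfolding a4_def
  proof (intro mult_mono frac_le)
    have "exp (b \<bullet> (X w + U w) - d * norm (X w + U w)) \<le> exp (b \<bullet> (X w + U w))" using d by simp
    also have "\<dots> \<le> envelope w" using b by (intro exp_inner_W_le_envelope) auto
    finally show "exp (b \<bullet> (X w + U w) - d * norm (X w + U w)) \<le> envelope w" .
    show "max 0 (integral {0..y} l - d * y) \<le> R * tau"
      using integral_0_bounds[OF l y] mult_nonneg_nonneg[OF d(1) y(1)] by linarith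
  qed (use m dom0 in auto)
  ultimately have a4: "\<bar>a4\<bar> \<le> R * tau / mgf M U b * envelope w" by (simp add: mult_ac)
  have i0: "0 \<le> integral {0..y} l0" "integral {0..y} l0 \<le> hi * tau"
    using integral_0_bounds[OF l0_cont less_imp_le[OF l0_pos] l0_upper y] by auto
  have "0 \<le> a5" using m i0 by (simp add: a5_def)
  moreover have "a5 \<le> envelope w / mgf M U b0 * (hi * tau)"
    unfolding a5_def
    using exp_inner_W_le_envelope[OF less_imp_le[OF norm_b0]] m i0 dom0 by (intro mult_mono frac_le) auto
  ultimately have a5: "\<bar>a5\<bar> \<le> hi * tau / mgf M U b0 * envelope w" by (simp add: mult_ac)
  have "excess l b d (X w, T w, C w, U w) = of_bool (T w \<le> C w) * (2 * (a1 - 1) + a2 + a3) - a4 + a5"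
    by (simp add: excess_def a1_def a2_def a3_def a4_def a5_def y_def)
  also have "\<bar>\<dots>\<bar> \<le> 2 * (\<bar>a1\<bar> + 1) + \<bar>a2\<bar> + \<bar>a3\<bar> + \<bar>a4\<bar> + \<bar>a5\<bar>"
    by (cases "T w \<le> C w") auto
  also have "\<dots> \<le> 2 * (sqrt ((R + D) / lo) * envelope w + envelope w) + 2 * envelope w + 2 * envelope w
      + R * tau / mgf M U b * envelope w + hi * tau / mgf M U b0 * envelope w"
    using a1 a2 a3 a4 a5 envelope_ge(1)[of w] by (intro add_mono mult_left_mono) simp_all
  finally show ?thesis by (simp only: algebra_simps)
qed

lemma integrable_excess:
  assumes l: "continuous_on UNIV l" "\<And>t. 0 \<le> l t" "\<And>t. l t \<le> R"
    and b: "norm b < D" and d: "0 \<le> d" "norm b + d \<le> D"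
  shows "integrable M (\<lambda>w. excess l b d (X w, T w, C w, U w))"
proof (rule Bochner_Integration.integrable_bound[OF integrable_mult_right[OF integrable_envelope]])
  show "(\<lambda>w. excess l b d (X w, T w, C w, U w)) \<in> borel_measurable M"
    by (rule measurable_compose[OF _ measurable_excess[OF l(1)]]) (simp add: borel_prod[symmetric])
  show "AE w in M. norm (excess l b d (X w, T w, C w, U w))
     \<le> norm ((2 * (sqrt ((R + D) / lo) + 1) + 4 + R * tau / mgf M U b + hi * tau / mgf M U b0) * envelope w)"
    using AE_Y_range
  proof eventually_elim
    case (elim w)
    from excess_bound[OF l b d elim] show ?case by simp
  qed
qed

lemma integral_excess_tendsto:
  assumes l: "continuous_on UNIV l" "\<And>t. 0 \<le> l t" "\<And>t. l t \<le> R"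
    and b: "norm b < D" and d: "d \<longlonglongrightarrow> 0" "\<And>n. 0 \<le> d n" "\<And>n. norm b + d n \<le> D"
  shows "(\<lambda>n. \<integral>w. excess l b (d n) (X w, T w, C w, U w) \<partial>M)
     \<longlonglongrightarrow> (\<integral>w. excess l b 0 (X w, T w, C w, U w) \<partial>M)"
proof (rule integral_dominated_convergence[OF _ _ integrable_mult_right[OF integrable_envelope]])
  have m [measurable]: "(\<lambda>w. excess l b d (X w, T w, C w, U w)) \<in> borel_measurable M" for d
    by (rule measurable_compose[OF _ measurable_excess[OF l(1)]]) (simp add: borel_prod[symmetric])
  show "(\<lambda>w. excess l b 0 (X w, T w, C w, U w)) \<in> borel_measurable M"
    "(\<lambda>w. excess l b (d n) (X w, T w, C w, U w)) \<in> borel_measurable M" for n by measurable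
  show "AE w in M. norm (excess l b (d n) (X w, T w, C w, U w))
     \<le> (2 * (sqrt ((R + D) / lo) + 1) + 4 + R * tau / mgf M U b + hi * tau / mgf M U b0) * envelope w" for n
    using AE_Y_range
  proof eventually_elim
    case (elim w)
    from excess_bound[OF l b d(2,3) elim] show ?case by simp
  qed
  have mp: "mgf M U b \<noteq> 0" using mgf_pos[OF b] by simp
  show "AE w in M. (\<lambda>n. excess l b (d n) (X w, T w, C w, U w)) \<longlonglongrightarrow> excess l b 0 (X w, T w, C w, U w)"
  proof (rule AE_I2)
    fix w
    have l0y: "l0 (min (T w) (C w)) \<noteq> 0" using l0_pos by (simp add: less_imp_neq[THEN not_sym])
    show "(\<lambda>n. excess l b (d n) (X w, T w, C w, U w)) \<longlonglongrightarrow> excess l b 0 (X w, T w, C w, U w)"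
      unfolding excess_def prod.case mgfd_0
      by (intro tendsto_intros d(1) mgfd_tendsto d(3) mp l0y)
  qed
qed

lemma measurable_integral_Y:
  fixes f :: "real \<Rightarrow> real"
  assumes f: "continuous_on UNIV f"
  shows "(\<lambda>w. integral {0..min (T w) (C w)} f) \<in> borel_measurable M"
    "(\<lambda>p. integral {0..min (fst (fst p)) (snd p)} f)
      \<in> borel_measurable ((borel \<Otimes>\<^sub>M (borel :: (real^'m) measure)) \<Otimes>\<^sub>M borel)"
  by (rule measurable_compose[OF _ borel_measurable_integral_atLeast0[OF f]]; simp)+

lemma integrable_exp_integral:
  fixes l :: "real \<Rightarrow> real"
  assumes l: "continuous_on UNIV l" "\<And>t. 0 \<le> l t" "\<And>t. l t \<le> R" and b: "norm b \<le> D"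
  shows "integrable M (\<lambda>w. exp (b \<bullet> X w) * integral {0..min (T w) (C w)} l)"
    "integrable M (\<lambda>w. exp (b \<bullet> (X w + U w)) * integral {0..min (T w) (C w)} l)"
proof -
  note [measurable] = measurable_integral_Y(1)[OF l(1)]
  have 1: "exp (b \<bullet> X w) \<le> envelope w" for w
  proof -
    have "b \<bullet> X w + 0 * norm (X w) \<le> D * norm (X w)" using b by (intro inner_add_norm_le) simp
    then have "exp (b \<bullet> X w) \<le> exp (D * norm (X w))" by simp
    then show ?thesis using envelope_ge(2)[of w] by linarith
  qed
  show "integrable M (\<lambda>w. exp (b \<bullet> X w) * integral {0..min (T w) (C w)} l)"
  proof (rule Bochner_Integration.integrable_bound[OF integrable_mult_left[OF integrable_envelope, of "R * tau"]])
    show "AE w in M. norm (exp (b \<bullet> X w) * integral {0..min (T w) (C w)} l) \<le> norm (envelope w * (R * tau))"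
      using AE_Y_range
    proof eventually_elim
      case (elim w)
      then have I: "0 \<le> integral {0..min (T w) (C w)} l" "integral {0..min (T w) (C w)} l \<le> R * tau"
        using integral_0_bounds[OF l] by auto
      have "exp (b \<bullet> X w) * integral {0..min (T w) (C w)} l \<le> envelope w * (R * tau)"
        using 1[of w] I envelope_ge(1)[of w] by (intro mult_mono) auto
      with I show ?case
        unfolding real_norm_def by (intro order_trans[OF _ abs_ge_self]) (simp add: abs_mult)
    qed
  qed measurable
  show "integrable M (\<lambda>w. exp (b \<bullet> (X w + U w)) * integral {0..min (T w) (C w)} l)"
  proof (rule Bochner_Integration.integrable_bound[OF integrable_mult_left[OF integrable_envelope, of "R * tau"]])
    show "AE w in M. norm (exp (b \<bullet> (X w + U w)) * integral {0..min (T w) (C w)} l) \<le> norm (envelope w * (R * tau))"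
      using AE_Y_range
    proof eventually_elim
      case (elim w)
      then have I: "0 \<le> integral {0..min (T w) (C w)} l" "integral {0..min (T w) (C w)} l \<le> R * tau"
        using integral_0_bounds[OF l] by auto
      have "exp (b \<bullet> (X w + U w)) * integral {0..min (T w) (C w)} l \<le> envelope w * (R * tau)"
        using exp_inner_W_le_envelope[OF b, of w] I envelope_ge(1)[of w] by (intro mult_mono) auto
      with I show ?case
        unfolding real_norm_def by (intro order_trans[OF _ abs_ge_self]) (simp add: abs_mult)
    qed
  qed measurable
qed

lemma integral_corrected:
  fixes l :: "real \<Rightarrow> real"
  assumes l: "continuous_on UNIV l" "\<And>t. 0 \<le> l t" "\<And>t. l t \<le> R" and b: "norm b < D"
  shows "(\<integral>w. exp (b \<bullet> (X w + U w)) / mgf M U b * integral {0..min (T w) (C w)} l \<partial>M)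
      = (\<integral>w. exp (b \<bullet> X w) * integral {0..min (T w) (C w)} l \<partial>M)"
proof -
  note [measurable] = measurable_integral_Y(2)[OF l(1)]
  let ?f = "\<lambda>p. exp (b \<bullet> snd (fst p)) * integral {0..min (fst (fst p)) (snd p)} l"
  have "integrable M (\<lambda>w. exp (b \<bullet> U w))" using integrable_mgfd[of b 0] b by simp
  then have "(\<integral>w. ?f ((T w, X w), C w) * exp (b \<bullet> U w) \<partial>M)
     = (\<integral>w. ?f ((T w, X w), C w) \<partial>M) * (\<integral>w. exp (b \<bullet> U w) \<partial>M)"
    using integrable_exp_integral(1)[OF l less_imp_le[OF b]]
    by (intro integral_indep_pair_mult(1)[OF indep_TXC_U', of ?f "\<lambda>u. exp (b \<bullet> u)"]) auto
  then have "(\<integral>w. exp (b \<bullet> (X w + U w)) * integral {0..min (T w) (C w)} l \<partial>M)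
     = (\<integral>w. exp (b \<bullet> X w) * integral {0..min (T w) (C w)} l \<partial>M) * mgf M U b"
    by (simp add: mgf_def inner_add_right exp_add mult_ac)
  then show ?thesis using mgf_pos[OF b] by (simp add: field_simps)
qed

lemma integrable_U: "integrable M U"
proof (rule Bochner_Integration.integrable_bound[OF integrable_divide[OF U_mom, of D]])
  show "AE w in M. norm (U w) \<le> norm (exp (D * norm (U w)) / D)"
  proof (rule AE_I2)
    fix w
    have "D * norm (U w) \<le> exp (D * norm (U w))" using exp_ge_add_one_self[of "D * norm (U w)"] by linarith
    then show "norm (U w) \<le> norm (exp (D * norm (U w)) / D)" using D_pos by (simp add: field_simps)
  qed
qed measurable

lemma integral_inner_U_event: 
  "integrable M (\<lambda>w. of_bool (T w \<le> C w) * (v \<bullet> U w))"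
  "(\<integral>w. of_bool (T w \<le> C w) * (v \<bullet> U w) \<partial>M) = 0"
proof -
  let ?f = "\<lambda>p :: (real \<times> (real^'m)) \<times> real. of_bool (fst (fst p) \<le> snd p) :: real"
  have f: "?f \<in> borel_measurable ((borel \<Otimes>\<^sub>M (borel :: (real^'m) measure)) \<Otimes>\<^sub>M borel)"
    by measurable
  have i1: "integrable M (\<lambda>w. ?f ((T w, X w), C w))"
    by (rule integrable_const_bound[where B=1]) auto
  have i2: "integrable M (\<lambda>w. v \<bullet> U w)" using integrable_U by simp
  note * = integral_indep_pair_mult[OF indep_TXC_U' f _ i1 i2]
  show "integrable M (\<lambda>w. of_bool (T w \<le> C w) * (v \<bullet> U w))" using *(2) by simp
  have "(\<integral>w. v \<bullet> U w \<partial>M) = 0" using integrable_U U_mean by simp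
  then show "(\<integral>w. of_bool (T w \<le> C w) * (v \<bullet> U w) \<partial>M) = 0" using *(1) by simp
qed

definition hell :: "(real \<Rightarrow> real) \<Rightarrow> real^'m \<Rightarrow> real^'m \<Rightarrow> real \<Rightarrow> real" where
  "hell l b x u = (exp (b \<bullet> x / 2) * sqrt (l u) - exp (b0 \<bullet> x / 2) * sqrt (l0 u))\<^sup>2"

lemma continuous_hell:
  assumes "continuous_on UNIV l"
  shows "continuous_on A (hell l b x)"
  unfolding hell_def
  by (intro continuous_intros continuous_on_subset[OF l0_cont] continuous_on_subset[OF assms]) auto

lemma integral_excess_0:
  assumes l: "continuous_on UNIV l" "\<And>t. 0 \<le> l t" "\<And>t. l t \<le> R" and b: "norm b < D"
  shows "integrable M (\<lambda>w. integral {0..min (T w) (C w)} (hell l b (X w)))" (is ?int)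
    and "(\<integral>w. excess l b 0 (X w, T w, C w, U w) \<partial>M)
      = - (\<integral>w. integral {0..min (T w) (C w)} (hell l b (X w)) \<partial>M)" (is ?eq)
proof -
  define Y where "Y w = min (T w) (C w)" for w
  define f where "f u = sqrt (l u / l0 u)" for u
  define s where "s u = sqrt (l u) * sqrt (l0 u)" for u
  define k where "k x = exp ((b - b0) \<bullet> x / 2)" for x :: "real^'m"
  define b1 where "b1 = (1/2) *\<^sub>R (b + b0)"
  have R: "0 \<le> R" using l(2)[of 0] l(3)[of 0] by linarith
  have f_cont: "continuous_on UNIV f"
    unfolding f_def using l0_pos by (intro continuous_intros l l0_cont) (auto simp: less_le)
  have f_nonneg: "0 \<le> f u" for u using l(2)[of u] l0_pos[of u] by (simp add: f_def)
  have s_cont: "continuous_on UNIV s" unfolding s_def by (intro continuous_intros l l0_cont)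
  have s_nonneg: "0 \<le> s u" for u using l(2)[of u] l0_pos[of u] by (simp add: s_def)
  have s_le: "s u \<le> sqrt R * sqrt hi" for u
    unfolding s_def using l(2,3)[of u] l0_pos[of u] l0_upper[of u] R by (intro mult_mono) auto
  have fs: "f u * l0 u = s u" for u
    using l(2)[of u] l0_pos[of u] by (simp add: f_def s_def real_sqrt_divide field_simps)
  have fs': "(\<lambda>u. f u * l0 u) = s" by (simp add: fs fun_eq_iff)
  have b1: "norm b1 \<le> D" unfolding b1_def using norm_triangle_ineq[of b b0] b norm_b0 by simp
  have k_meas [measurable]: "k \<in> borel_measurable borel" unfolding k_def by measurable
  have k_int: "integrable M (\<lambda>w. k (X w))"
  proof (rule Bochner_Integration.integrable_bound[OF X_mom])
    have n: "norm ((1/2) *\<^sub>R (b - b0)) + 0 \<le> D"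
      using norm_triangle_ineq4[of b b0] b norm_b0 by simp
    have "k (X w) \<le> exp (D * norm (X w))" for w
      using inner_add_norm_le[OF n, of "X w"] by (simp add: k_def)
    then show "AE w in M. norm (k (X w)) \<le> norm (exp (D * norm (X w)))" by (simp add: k_def)
  qed measurable
  have kb: "k x * exp (b0 \<bullet> x) = exp (b1 \<bullet> x)" for x
    by (simp add: k_def b1_def exp_add[symmetric] inner_diff_left inner_add_left field_simps)
  note iS = integrable_exp_integral(1)[OF s_cont s_nonneg s_le b1]
  note iL = integrable_exp_integral[OF l less_imp_le[OF b]]
  note i0 = integrable_exp_integral[OF l0_cont less_imp_le[OF l0_pos] l0_upper less_imp_le[OF norm_b0]]
  have hell_int: "integral {0..y} (hell l b x) = exp (b \<bullet> x) * integral {0..y} l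
     - 2 * (exp (b1 \<bullet> x) * integral {0..y} s) + exp (b0 \<bullet> x) * integral {0..y} l0" for x y
  proof -
    have I: "l integrable_on {0..y}" "s integrable_on {0..y}" "l0 integrable_on {0..y}"
      by (intro integrable_continuous_real continuous_on_subset[OF l(1)] continuous_on_subset[OF s_cont]
          continuous_on_subset[OF l0_cont] subset_UNIV)+
    have "hell l b x u = exp (b \<bullet> x) * l u - 2 * exp (b1 \<bullet> x) * s u + exp (b0 \<bullet> x) * l0 u" for u
    proof -
      have e: "(exp (c \<bullet> x / 2))\<^sup>2 = exp (c \<bullet> x)" for c :: "real^'m"
        by (simp add: power2_eq_square exp_add[symmetric])
      have e1: "exp (b1 \<bullet> x) = exp (b \<bullet> x / 2) * exp (b0 \<bullet> x / 2)"
        by (simp add: b1_def exp_add[symmetric] inner_add_left field_simps)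
      show ?thesis using l(2)[of u] l0_pos[of u]
        by (simp add: hell_def power2_diff power_mult_distrib e e1 s_def)
    qed
    then have "integral {0..y} (hell l b x) = integral {0..y} (\<lambda>u. exp (b \<bullet> x) * l u - 2 * exp (b1 \<bullet> x) * s u + exp (b0 \<bullet> x) * l0 u)"
      by presburger
    also have "\<dots> = exp (b \<bullet> x) * integral {0..y} l
     - 2 * exp (b1 \<bullet> x) * integral {0..y} s + exp (b0 \<bullet> x) * integral {0..y} l0"
      using I by (simp add: integral_add integral_diff integrable_diff)
    finally show ?thesis by simp
  qed
  show ?int unfolding hell_int using iS iL(1) i0(1) by simp
  have "(\<integral>w. k (X w) * (of_bool (T w \<le> C w) * f (Y w)) \<partial>M)
      = (\<integral>w. k (X w) * exp (b0 \<bullet> X w) * integral {0..Y w} (\<lambda>u. f u * l0 u) \<partial>M)"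
    unfolding Y_def by (rule compensator[OF k_meas k_int _ f_cont f_nonneg]) (simp add: k_def)
  then have A1: "(\<integral>w. k (X w) * (of_bool (T w \<le> C w) * f (Y w)) \<partial>M) = (\<integral>w. exp (b1 \<bullet> X w) * integral {0..Y w} s \<partial>M)"
    by (simp only: kb fs')
  have "(\<integral>w. 1 * (of_bool (T w \<le> C w) * 1) \<partial>M) = (\<integral>w. 1 * exp (b0 \<bullet> X w) * integral {0..Y w} (\<lambda>u. 1 * l0 u) \<partial>M)"
    unfolding Y_def by (rule compensator) auto
  then have A2: "(\<integral>w. of_bool (T w \<le> C w) \<partial>M) = (\<integral>w. exp (b0 \<bullet> X w) * integral {0..Y w} l0 \<partial>M)"
    by simp
  have fY [measurable]: "(\<lambda>w. f (Y w)) \<in> borel_measurable M"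
    unfolding Y_def by (rule measurable_compose[OF _ borel_measurable_continuous_onI[OF f_cont]]) simp
  have f_le: "f u \<le> sqrt (R / lo)" for u
    unfolding f_def using l(2,3)[of u] l0_lower[of u] lo_pos R by (intro real_sqrt_le_mono frac_le) auto
  have iA1: "integrable M (\<lambda>w. k (X w) * (of_bool (T w \<le> C w) * f (Y w)))"
  proof (rule Bochner_Integration.integrable_bound[OF integrable_mult_left[OF k_int, of "sqrt (R / lo)"]])
    show "AE w in M. norm (k (X w) * (of_bool (T w \<le> C w) * f (Y w))) \<le> norm (k (X w) * sqrt (R / lo))"
      using f_le f_nonneg R lo_pos by (auto simp: abs_mult k_def)
  qed measurable
  have iA2: "integrable M (\<lambda>w. of_bool (T w \<le> C w) :: real)"
    by (rule integrable_const_bound[where B=1]) auto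
  have "excess l b 0 (X w, T w, C w, U w) = 2 * (k (X w) * (of_bool (T w \<le> C w) * f (Y w))) - 2 * of_bool (T w \<le> C w)
      + of_bool (T w \<le> C w) * ((b - b0) \<bullet> U w)
      - exp (b \<bullet> (X w + U w)) / mgf M U b * integral {0..Y w} l
      + exp (b0 \<bullet> (X w + U w)) / mgf M U b0 * integral {0..Y w} l0" for w
  proof -
    have "0 \<le> integral {0..Y w} l"
      using l by (intro integral_nonneg integrable_continuous_real continuous_on_subset[OF l(1)]) auto
    then show ?thesis by (simp add: excess_def mgfd_0 Y_def f_def k_def algebra_simps)
  qed
  then have "(\<integral>w. excess l b 0 (X w, T w, C w, U w) \<partial>M)
     = 2 * (\<integral>w. k (X w) * (of_bool (T w \<le> C w) * f (Y w)) \<partial>M) - 2 * (\<integral>w. of_bool (T w \<le> C w) \<partial>M)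
      + (\<integral>w. of_bool (T w \<le> C w) * ((b - b0) \<bullet> U w) \<partial>M)
      - (\<integral>w. exp (b \<bullet> (X w + U w)) / mgf M U b * integral {0..Y w} l \<partial>M)
      + (\<integral>w. exp (b0 \<bullet> (X w + U w)) / mgf M U b0 * integral {0..Y w} l0 \<partial>M)"
    using iA1 iA2 integral_inner_U_event(1) iL(2) i0(2) by (simp add: Y_def)
  also have "\<dots> = 2 * (\<integral>w. exp (b1 \<bullet> X w) * integral {0..Y w} s \<partial>M) - (\<integral>w. exp (b0 \<bullet> X w) * integral {0..Y w} l0 \<partial>M)
      - (\<integral>w. exp (b \<bullet> X w) * integral {0..Y w} l \<partial>M)"
    unfolding A1 A2 integral_inner_U_event(2)
    using integral_corrected[OF l b] integral_corrected[OF l0_cont less_imp_le[OF l0_pos] l0_upper norm_b0]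
    by (simp add: Y_def)
  also have "\<dots> = - (\<integral>w. integral {0..Y w} (hell l b (X w)) \<partial>M)"
    unfolding hell_int using iS iL(1) i0(1) by (simp add: Y_def)
  finally show ?eq by (simp add: Y_def)
qed

definition qtrue :: "(real^'m) \<times> real \<times> real \<times> (real^'m) \<Rightarrow> real" where
  "qtrue = (\<lambda>(x, t, c, u). of_bool (t \<le> c) * (ln (l0 (min t c)) + b0 \<bullet> (x + u))
     - exp (b0 \<bullet> (x + u)) / mgf M U b0 * integral {0..min t c} l0)"

lemma qfun_le_excess:
  assumes l: "continuous_on UNIV l" "\<And>s. 0 \<le> l s"
    and l': "\<And>s. s \<in> {0..tau} \<Longrightarrow> 0 \<le> l' s" "\<And>s. s \<in> {0..tau} \<Longrightarrow> \<bar>l' s - l s\<bar> \<le> d"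
      "continuous_on {0..tau} l'"
    and b: "norm b < D" "norm b + d \<le> D" "norm (b' - b) \<le> d" "norm b' < D"
    and tc: "0 < t" "0 \<le> c" "c \<le> tau"
  shows "qfun (mgf M U) (observ t c x u) (l', b') \<le> ereal (excess l b d (x, t, c, u) + qtrue (x, t, c, u))"
proof -
  define y where "y = min t c"
  define W where "W = x + u"
  have y: "0 \<le> y" "y \<le> tau" using tc by (auto simp: y_def)
  have d: "0 \<le> d" using b(3) norm_ge_zero[of "b' - b"] by linarith
  have dW: "\<bar>(b' - b) \<bullet> W\<bar> \<le> d * norm W"
    using Cauchy_Schwarz_ineq2[of "b' - b" W] mult_right_mono[OF b(3) norm_ge_zero[of W]] by linarith
  have i: "l integrable_on {0..y}" "l' integrable_on {0..y}"
    using y by (auto intro!: integrable_continuous_real intro: continuous_on_subset[OF l(1)] continuous_on_subset[OF l'(3)])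
  have "integral {0..y} l - d * y = integral {0..y} (\<lambda>s. l s - d)"
    using i y by (subst Henstock_Kurzweil_Integration.integral_diff) auto
  also have "\<dots> \<le> integral {0..y} l'"
    using i y l'(2) by (intro integral_le integrable_diff) (auto simp: abs_le_iff algebra_simps)
  finally have I1: "integral {0..y} l - d * y \<le> integral {0..y} l'" .
  have I2: "0 \<le> integral {0..y} l'" using i y l'(1) by (intro integral_nonneg) auto
  have m: "0 < mgf M U b'" "mgf M U b' \<le> mgfd b d"
    using mgf_pos[OF b(4)] mgf_le_mgfd[OF b(2,3)] by auto
  have second: "exp (b \<bullet> W - d * norm W) / mgfd b d * max 0 (integral {0..y} l - d * y)
      \<le> exp (b' \<bullet> W) / mgf M U b' * integral {0..y} l'"
  proof (intro mult_mono frac_le)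
    show "exp (b \<bullet> W - d * norm W) \<le> exp (b' \<bullet> W)"
      using dW by (simp add: inner_diff_left abs_le_iff)
  qed (use m I1 I2 in auto)
  have first: "ln (l' y) + b' \<bullet> W \<le> 2 * (sqrt ((l y + d) / l0 y) * exp ((b - b0) \<bullet> x / 2) - 1)
      + (b - b0) \<bullet> u + d * norm W + (ln (l0 y) + b0 \<bullet> W)" if pos: "l' y > 0"
  proof -
    have ly: "l' y \<le> l y + d" using l'(2)[of y] y by (auto simp: abs_le_iff)
    then have lyd: "0 < l y + d" using pos by linarith
    define r where "r = sqrt ((l y + d) / l0 y) * exp ((b - b0) \<bullet> x / 2)"
    have rpos: "0 < r" using lyd l0_pos[of y] by (simp add: r_def)
    have "2 * ln r = ln (l y + d) - ln (l0 y) + (b - b0) \<bullet> x"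
      using lyd l0_pos[of y] by (simp add: r_def ln_mult ln_sqrt ln_div)
    moreover have "ln r \<le> r - 1" by (rule ln_le_minus_one[OF rpos])
    moreover have "ln (l' y) \<le> ln (l y + d)" using ly pos lyd by simp
    ultimately have "ln (l' y) \<le> 2 * (r - 1) + ln (l0 y) - (b - b0) \<bullet> x" by argo
    moreover have "b' \<bullet> W \<le> b \<bullet> W + d * norm W" using dW by (simp add: inner_diff_left abs_le_iff)
    moreover have "b \<bullet> W = (b - b0) \<bullet> x + (b - b0) \<bullet> u + b0 \<bullet> W"
      by (simp add: W_def inner_diff_left inner_add_right)
    ultimately show ?thesis unfolding r_def[symmetric] by linarith
  qed
  have rhs: "excess l b d (x, t, c, u) + qtrue (x, t, c, u)
     = of_bool (t \<le> c) * (2 * (sqrt ((l y + d) / l0 y) * exp ((b - b0) \<bullet> x / 2) - 1)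
      + (b - b0) \<bullet> u + d * norm W + (ln (l0 y) + b0 \<bullet> W))
      - exp (b \<bullet> W - d * norm W) / mgfd b d * max 0 (integral {0..y} l - d * y)"
    by (simp add: excess_def qtrue_def y_def W_def algebra_simps)
  show ?thesis
  proof (cases "t \<le> c \<and> l' y = 0")
    case True
    then show ?thesis by (auto simp: qfun_def observ_def y_def min_def)
  next
    case False
    have "qfun (mgf M U) (observ t c x u) (l', b')
      = ereal (of_bool (t \<le> c) * (ln (l' y) + b' \<bullet> W) - exp (b' \<bullet> W) / mgf M U b' * integral {0..y} l')"
      using False by (auto simp: qfun_def observ_def y_def W_def)
    moreover have "of_bool (t \<le> c) * (ln (l' y) + b' \<bullet> W) \<le> of_bool (t \<le> c) *
       (2 * (sqrt ((l y + d) / l0 y) * exp ((b - b0) \<bullet> x / 2) - 1)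
      + (b - b0) \<bullet> u + d * norm W + (ln (l0 y) + b0 \<bullet> W))"
      using False first l'(1)[of y] y by (cases "t \<le> c") auto
    ultimately show ?thesis unfolding rhs using second by simp
  qed
qed

lemma qfun_true:
  assumes lam: "\<And>s. s \<in> {0..tau} \<Longrightarrow> lam s = l0 s" and tc: "0 < t" "0 \<le> c" "c \<le> tau"
  shows "qfun (mgf M U) (observ t c x u) (lam, b0) = ereal (qtrue (x, t, c, u))"
proof -
  have y: "min t c \<in> {0..tau}" using tc by auto
  have "integral {0..min t c} lam = integral {0..min t c} l0"
    using y by (intro integral_cong lam) auto
  then show ?thesis
    using lam[OF y] l0_pos[of "min t c"] by (auto simp: qfun_def observ_def qtrue_def)
qed

subsection \<open>Identifiability\<close>

lemma integrable_norm_X_sq: "integrable M (\<lambda>w. (norm (X w))\<^sup>2)"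
proof (rule Bochner_Integration.integrable_bound[OF integrable_mult_right[OF X_mom, of "2 / D\<^sup>2"]])
  show "AE w in M. norm ((norm (X w))\<^sup>2) \<le> norm (2 / D\<^sup>2 * exp (D * norm (X w)))"
  proof (rule AE_I2)
    fix w
    have "1 + D * norm (X w) + (D * norm (X w))\<^sup>2 / 2 \<le> exp (D * norm (X w))"
      using D_pos by (intro exp_lower_Taylor_quadratic) auto
    moreover have "0 \<le> D * norm (X w)" using D_pos by simp
    ultimately have "(D * norm (X w))\<^sup>2 \<le> 2 * exp (D * norm (X w))" by linarith
    then show "norm ((norm (X w))\<^sup>2) \<le> norm (2 / D\<^sup>2 * exp (D * norm (X w)))"
      using D_pos by (simp add: power_mult_distrib field_simps)
  qed
qed measurable

lemma measurable_nth_X [measurable]: "(\<lambda>w. X w $ i) \<in> borel_measurable M"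
  using measurable_compose[OF meas(1), of "\<lambda>x. x $ i"] by measurable

lemma integrable_X_prod: "integrable M (\<lambda>w. X w $ i * X w $ j)"
proof (rule Bochner_Integration.integrable_bound[OF integrable_norm_X_sq])
  show "AE w in M. norm (X w $ i * X w $ j) \<le> norm ((norm (X w))\<^sup>2)"
    by (auto simp: abs_mult power2_eq_square intro!: mult_mono component_le_norm_cart)
qed measurable

lemma integrable_X_nth: "integrable M (\<lambda>w. X w $ i)"
proof (rule square_integrable_imp_integrable)
  show "integrable M (\<lambda>w. (X w $ i)\<^sup>2)" using integrable_X_prod[of i i] by (simp add: power2_eq_square)
qed measurable

lemma constant_inner_X:
  assumes "AE w in M. v \<bullet> X w = c"
  shows "v = 0"
proof (rule ccontr)
  assume v: "v \<noteq> 0"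
  define Z where "Z i w = X w $ i - (\<integral>v. X v $ i \<partial>M)" for i w
  have ZZ: "integrable M (\<lambda>w. Z i w * Z j w)" for i j
  proof -
    have "Z i w * Z j w = X w $ i * X w $ j - (\<integral>v. X v $ i \<partial>M) * X w $ j
       - X w $ i * (\<integral>v. X v $ j \<partial>M) + (\<integral>v. X v $ i \<partial>M) * (\<integral>v. X v $ j \<partial>M)" for w
      by (simp add: Z_def algebra_simps)
    then show ?thesis using integrable_X_prod integrable_X_nth by simp
  qed
  have sumX: "(\<Sum>i\<in>UNIV. v $ i * X w $ i) = v \<bullet> X w" for w by (simp add: inner_vec_def)
  have "(\<Sum>i\<in>UNIV. v $ i * (\<integral>w. X w $ i \<partial>M)) = (\<integral>w. v \<bullet> X w \<partial>M)"
    unfolding sumX[symmetric] using integrable_X_nth by simp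
  also have "\<dots> = (\<integral>w. c \<partial>M)"
    by (rule integral_cong_AE) (use assms in auto)
  also have "\<dots> = c" by (simp add: prob_space)
  finally have mean: "(\<Sum>i\<in>UNIV. v $ i * (\<integral>w. X w $ i \<partial>M)) = c" .
  have "v \<bullet> (cov_matrix M X *v v) = (\<Sum>i\<in>UNIV. v $ i * (\<Sum>j\<in>UNIV. (\<integral>w. Z i w * Z j w \<partial>M) * v $ j))"
    by (simp add: inner_vec_def matrix_vector_mult_def cov_matrix_def Z_def)
  also have "\<dots> = (\<integral>w. (\<Sum>i\<in>UNIV. v $ i * (\<Sum>j\<in>UNIV. (Z i w * Z j w) * v $ j)) \<partial>M)"
    using ZZ by simp
  also have "\<dots> = (\<integral>w. 0 \<partial>M)"
  proof (rule integral_cong_AE)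
    show "AE w in M. (\<Sum>i\<in>UNIV. v $ i * (\<Sum>j\<in>UNIV. (Z i w * Z j w) * v $ j)) = 0"
      using assms
    proof eventually_elim
      case (elim w)
      have "(\<Sum>j\<in>UNIV. Z j w * v $ j) = 0"
        using mean elim by (simp add: Z_def right_diff_distrib sum_subtractf sumX[symmetric] mult.commute)
      then have "(\<Sum>j\<in>UNIV. (Z i w * Z j w) * v $ j) = 0" for i
        by (simp add: mult.assoc sum_distrib_left[symmetric])
      then show ?case by simp
    qed
  qed (auto simp: Z_def)
  finally show False using cov_pd v by (auto simp: pos_def_matrix_def)
qed

lemma prob_T_C_gt:
  assumes t: "0 \<le> t" "t < tau"
  shows "0 < prob {w \<in> space M. t < T w \<and> t < C w}"
proof -
  have "prob {w \<in> space M. T w > t} = (\<integral>w. exp (- exp (b0 \<bullet> X w) * integral {0..t} l0) \<partial>M)"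
    using cox[of UNIV t] t by simp
  also have "\<dots> > 0"
  proof (rule integral_pos)
    have "0 \<le> integral {0..t} l0"
      using integral_0_bounds[OF l0_cont less_imp_le[OF l0_pos] l0_upper] t by auto
    then show "integrable M (\<lambda>w. exp (- exp (b0 \<bullet> X w) * integral {0..t} l0))"
      by (intro integrable_const_bound[where B=1]) auto
  qed auto
  finally have "0 < prob {w \<in> space M. T w > t}" .
  moreover have "0 < prob {w \<in> space M. C w > t}" using C_pos[of "tau - t"] t by simp
  moreover have "prob {w \<in> space M. t < T w \<and> t < C w} = prob {w \<in> space M. T w > t} * prob {w \<in> space M. C w > t}"
  proof -
    have "{t<..} \<times> UNIV \<in> sets (borel :: (real \<times> (real^'m)) measure)"
      by (simp add: borel_prod[symmetric])
    from indep3[OF this, of "{t<..}" UNIV] show ?thesis by (simp add: prob_space)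
  qed
  ultimately show ?thesis by simp
qed

lemma identifiable:
  assumes l: "continuous_on UNIV l" "\<And>s. 0 \<le> l s" "\<And>s. l s \<le> R" and b: "norm b < D"
    and zero: "(\<integral>w. integral {0..min (T w) (C w)} (hell l b (X w)) \<partial>M) = 0"
  shows "b = b0" "\<And>s. s \<in> {0..tau} \<Longrightarrow> l s = l0 s"
proof -
  have nonneg: "0 \<le> integral {0..y} (hell l b x)" for x y
    by (intro integral_nonneg integrable_continuous_real continuous_hell l) (simp add: hell_def)
  have "AE w in M. integral {0..min (T w) (C w)} (hell l b (X w)) = 0"
    using integral_nonneg_eq_0_iff_AE[OF integral_excess_0(1)[OF l b]] zero nonneg by simp
  then have eq: "AE w in M. \<forall>s. 0 \<le> s \<and> s < T w \<and> s < C w \<longrightarrow> exp (b \<bullet> X w) * l s = exp (b0 \<bullet> X w) * l0 s"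
  proof eventually_elim
    case (elim w)
    show ?case
    proof (intro allI impI)
      fix s assume s: "0 \<le> s \<and> s < T w \<and> s < C w"
      have "(integral {0..min (T w) (C w)} (hell l b (X w)) = 0) \<longleftrightarrow> (\<forall>s\<in>{0..min (T w) (C w)}. hell l b (X w) s = 0)"
        using s by (intro integral_eq_0_iff continuous_hell l) (auto simp: hell_def)
      with elim s have "hell l b (X w) s = 0" by auto
      then have "(exp (b \<bullet> X w / 2) * sqrt (l s))\<^sup>2 = (exp (b0 \<bullet> X w / 2) * sqrt (l0 s))\<^sup>2"
        by (simp add: hell_def)
      moreover have e: "(exp (c \<bullet> X w / 2))\<^sup>2 = exp (c \<bullet> X w)" for c
        by (simp add: power2_eq_square exp_add[symmetric])
      ultimately show "exp (b \<bullet> X w) * l s = exp (b0 \<bullet> X w) * l0 s"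
        using l(2)[of s] l0_pos[of s] by (simp add: power_mult_distrib)
    qed
  qed
  have l_pos: "0 < l 0"
  proof -
    obtain w where "w \<in> {w \<in> space M. 0 < T w \<and> 0 < C w}"
      and w: "\<forall>s. 0 \<le> s \<and> s < T w \<and> s < C w \<longrightarrow> exp (b \<bullet> X w) * l s = exp (b0 \<bullet> X w) * l0 s"
      using AE_prob_pos_obtain[OF eq prob_T_C_gt[of 0]] tau_pos by auto
    then have "exp (b \<bullet> X w) * l 0 = exp (b0 \<bullet> X w) * l0 0" by auto
    then have "l 0 \<noteq> 0" using l0_pos[of 0] by auto
    with l(2)[of 0] show ?thesis by simp
  qed
  define \<kappa> where "\<kappa> = ln (l0 0) - ln (l 0)"
  have v: "AE w in M. 0 < C w \<longrightarrow> (b - b0) \<bullet> X w = \<kappa>"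
    using eq AE_T_pos
  proof eventually_elim
    case (elim w)
    show ?case
    proof
      assume "0 < C w"
      with elim have "exp (b \<bullet> X w) * l 0 = exp (b0 \<bullet> X w) * l0 0" by auto
      then have "ln (exp (b \<bullet> X w) * l 0) = ln (exp (b0 \<bullet> X w) * l0 0)" by simp
      then have "b \<bullet> X w + ln (l 0) = b0 \<bullet> X w + ln (l0 0)"
        using l_pos l0_pos[of 0] by (simp add: ln_mult)
      then show "(b - b0) \<bullet> X w = \<kappa>" by (simp add: \<kappa>_def inner_diff_left)
    qed
  qed
  have "prob {w \<in> space M. (b - b0) \<bullet> X w \<noteq> \<kappa>} * prob {w \<in> space M. C w > 0}
     = prob {w \<in> space M. (b - b0) \<bullet> X w \<noteq> \<kappa> \<and> C w > 0}"
  proof -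
    have "{p. (b - b0) \<bullet> snd p \<noteq> \<kappa>} \<in> sets (borel :: (real \<times> (real^'m)) measure)"
      by (intro borel_open open_Collect_neq continuous_intros)
    from indep3[OF this, of "{0<..}" UNIV] show ?thesis by (simp add: prob_space)
  qed
  also have "\<dots> = 0"
    using v by (subst prob_Collect_eq_0) (auto elim!: eventually_mono)
  finally have "prob {w \<in> space M. (b - b0) \<bullet> X w \<noteq> \<kappa>} = 0" using C_pos[of tau] tau_pos by simp
  then have "AE w in M. (b - b0) \<bullet> X w = \<kappa>" by (subst (asm) prob_Collect_eq_0) auto
  from constant_inner_X[OF this] show bb: "b = b0" by simp
  have lt: "l s = l0 s" if s: "s \<in> {0..<tau}" for s
  proof -
    have s': "0 \<le> s" "s < tau" using s by auto
    obtain w where "w \<in> {w \<in> space M. s < T w \<and> s < C w}"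
      and w: "\<forall>s. 0 \<le> s \<and> s < T w \<and> s < C w \<longrightarrow> exp (b \<bullet> X w) * l s = exp (b0 \<bullet> X w) * l0 s"
      using AE_prob_pos_obtain[OF eq prob_T_C_gt[OF s']] by auto
    then show ?thesis using s' bb by auto
  qed
  have "closed {s. l s = l0 s}" by (intro closed_Collect_eq l l0_cont)
  moreover have "{0..<tau} \<subseteq> {s. l s = l0 s}" using lt by auto
  ultimately have "closure {0..<tau} \<subseteq> {s. l s = l0 s}" by (intro closure_minimal)
  then show "\<And>s. s \<in> {0..tau} \<Longrightarrow> l s = l0 s" using tau_pos by auto
qed

lemma exists_negative_excess:
  assumes l: "continuous_on UNIV l" "\<And>s. 0 \<le> l s" "\<And>s. l s \<le> R" and b: "norm b < D"
    and ne: "b \<noteq> b0 \<or> (\<exists>s\<in>{0..tau}. l s \<noteq> l0 s)"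
  obtains d where "0 < d" "norm b + d \<le> D" "(\<integral>w. excess l b d (X w, T w, C w, U w) \<partial>M) < 0"
proof -
  define d where "d n = (D - norm b) / real (Suc n)" for n
  have d_pos: "0 < d n" for n using b by (simp add: d_def)
  have d_le: "norm b + d n \<le> D" for n
  proof -
    have "d n \<le> (D - norm b) / 1" unfolding d_def using b by (intro divide_left_mono) auto
    then show ?thesis by simp
  qed
  have d_lim: "d \<longlonglongrightarrow> 0"
    unfolding d_def by (rule LIMSEQ_Suc[OF lim_const_over_n])
  let ?J = "\<integral>w. integral {0..min (T w) (C w)} (hell l b (X w)) \<partial>M"
  have "0 \<le> integral {0..y} (hell l b x)" for x y
    by (intro integral_nonneg integrable_continuous_real continuous_hell l) (simp add: hell_def)
  then have "0 \<le> ?J" by simp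
  moreover have "?J \<noteq> 0" using identifiable[OF l b] ne by blast
  ultimately have "(\<integral>w. excess l b 0 (X w, T w, C w, U w) \<partial>M) < 0"
    unfolding integral_excess_0(2)[OF l b] by simp
  then have "\<forall>\<^sub>F n in sequentially. (\<integral>w. excess l b (d n) (X w, T w, C w, U w) \<partial>M) < 0"
    using integral_excess_tendsto[OF l b d_lim less_imp_le[OF d_pos] d_le] by (rule order_tendstoD[rotated])
  then obtain n where "(\<integral>w. excess l b (d n) (X w, T w, C w, U w) \<partial>M) < 0"
    using eventually_happens[of _ sequentially] by auto
  with that[of "d n"] d_pos d_le show thesis by auto
qed

end

section \<open>Compactness of the parameter set\<close>

definition clip :: "real \<Rightarrow> real \<Rightarrow> real" where
  "clip tau t = max 0 (min tau t)"

lemma clip_in: "0 \<le> tau \<Longrightarrow> clip tau t \<in> {0..tau}"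
  by (auto simp: clip_def)

lemma clip_id: "t \<in> {0..tau} \<Longrightarrow> clip tau t = t"
  by (auto simp: clip_def)

lemma continuous_clip: "continuous_on A (clip tau)"
  unfolding clip_def by (intro continuous_intros)

lemma KlamD:
  assumes "f \<in> Klam L tau" "0 \<le> L"
  shows "t \<in> {0..tau} \<Longrightarrow> 0 \<le> f t" "continuous_on {0..tau} f"
    "t \<in> {0..tau} \<Longrightarrow> \<bar>f t - f 0\<bar> \<le> L * tau"
proof -
  have lip: "\<bar>f t - f s\<bar> \<le> L * \<bar>t - s\<bar>" if "t \<in> {0..tau}" "s \<in> {0..tau}" for t s
    using assms that by (auto simp: Klam_def)
  show "t \<in> {0..tau} \<Longrightarrow> 0 \<le> f t" using assms by (auto simp: Klam_def)
  have "L-lipschitz_on {0..tau} f" using lip assms by (intro lipschitz_onI) (auto simp: dist_real_def)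
  then show "continuous_on {0..tau} f" by (rule lipschitz_on_continuous_on)
  assume t: "t \<in> {0..tau}"
  then have "\<bar>f t - f 0\<bar> \<le> L * \<bar>t - 0\<bar>" by (intro lip) auto
  also have "\<dots> \<le> L * tau" using t assms by (intro mult_left_mono) auto
  finally show "\<bar>f t - f 0\<bar> \<le> L * tau" .
qed

definition clipfun :: "real \<Rightarrow> (real \<Rightarrow> real) \<Rightarrow> (real \<Rightarrow>\<^sub>C real)" where
  "clipfun tau f = Bcontfun (\<lambda>t. f (clip tau t))"

lemma clipfun_apply:
  assumes "f \<in> Klam L tau" "0 \<le> L" "0 \<le> tau"
  shows "apply_bcontfun (clipfun tau f) t = f (clip tau t)"
proof -
  have "continuous_on UNIV (\<lambda>t. f (clip tau t))"
    using clip_in[OF assms(3)]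
    by (intro continuous_on_compose2[OF KlamD(2)[OF assms(1,2)] continuous_clip]) auto
  moreover have "bounded (range (\<lambda>t. f (clip tau t)))"
  proof (rule boundedI)
    fix x assume "x \<in> range (\<lambda>t. f (clip tau t))"
    then obtain t where "x = f (clip tau t)" by blast
    then show "norm x \<le> \<bar>f 0\<bar> + L * tau"
      using KlamD(3)[OF assms(1,2) clip_in[OF assms(3), of t]] by simp
  qed
  ultimately have "(\<lambda>t. f (clip tau t)) \<in> bcontfun" by (simp add: bcontfun_def)
  then show ?thesis by (simp add: clipfun_def Bcontfun_inverse)
qed

lemma compact_clipfun_Klam:
  assumes L: "0 < L" and tau: "0 \<le> tau"
  shows "compact (clipfun tau ` {f \<in> Klam L tau. f 0 \<le> R})"
  unfolding compact_eq_seq_compact_metric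
proof (rule seq_compactI)
  fix F :: "nat \<Rightarrow> real \<Rightarrow>\<^sub>C real"
  assume "\<forall>n. F n \<in> clipfun tau ` {f \<in> Klam L tau. f 0 \<le> R}"
  then have "\<forall>n. \<exists>f. f \<in> Klam L tau \<and> f 0 \<le> R \<and> F n = clipfun tau f" by auto
  then obtain f where f: "\<And>n. f n \<in> Klam L tau" "\<And>n. f n 0 \<le> R" "\<And>n. F n = clipfun tau (f n)" by metis
  have L0: "0 \<le> L" using L by simp
  obtain g k where g: "continuous_on {0..tau} g" and k: "strict_mono (k :: nat \<Rightarrow> nat)"
    and lim: "\<And>e. 0 < e \<Longrightarrow> \<exists>N. \<forall>n x. n \<ge> N \<and> x \<in> {0..tau} \<longrightarrow> norm (f (k n) x - g x) < e"
  proof (rule Arzela_Ascoli[of "{0..tau}" f "R + L * tau"])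
    fix n x assume x: "x \<in> {0..tau}"
    show "norm (f n x) \<le> R + L * tau"
      using KlamD(1,3)[OF f(1) L0 x, of n] f(2)[of n] by (auto simp: abs_le_iff)
  next
    fix x e :: real assume x: "x \<in> {0..tau}" and e: "0 < e"
    show "\<exists>d>0. \<forall>n y. y \<in> {0..tau} \<and> norm (x - y) < d \<longrightarrow> norm (f n x - f n y) < e"
    proof (intro exI[of _ "e / L"] conjI allI impI)
      fix n y assume y: "y \<in> {0..tau} \<and> norm (x - y) < e / L"
      have "norm (f n x - f n y) \<le> L * \<bar>x - y\<bar>" using f(1)[of n] x y by (auto simp: Klam_def)
      also have "\<dots> < e" using y L by (simp add: field_simps)
      finally show "norm (f n x - f n y) < e" .
    qed (use e L in simp)
  qed auto
  have pw: "(\<lambda>n. f (k n) x) \<longlonglongrightarrow> g x" if "x \<in> {0..tau}" for x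
    unfolding LIMSEQ_iff using lim that by meson
  have gK: "g \<in> Klam L tau"
    unfolding Klam_def
  proof (intro CollectI conjI ballI)
    fix t assume t: "t \<in> {0..tau}"
    show "0 \<le> g t" by (rule LIMSEQ_le_const[OF pw[OF t]]) (use KlamD(1)[OF f(1) L0 t] in auto)
    fix s assume s: "s \<in> {0..tau}"
    have "(\<lambda>n. \<bar>f (k n) t - f (k n) s\<bar>) \<longlonglongrightarrow> \<bar>g t - g s\<bar>" by (intro tendsto_intros pw t s)
    then show "\<bar>g t - g s\<bar> \<le> L * \<bar>t - s\<bar>"
      by (rule LIMSEQ_le_const2) (use f(1) t s in \<open>auto simp: Klam_def\<close>)
  qed
  have "g 0 \<le> R" by (rule LIMSEQ_le_const2[OF pw]) (use tau f(2) in auto)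
  moreover have "(F \<circ> k) \<longlonglongrightarrow> clipfun tau g"
  proof (rule metric_LIMSEQ_I)
    fix r :: real assume r: "0 < r"
    then obtain N where N: "\<And>n x. n \<ge> N \<Longrightarrow> x \<in> {0..tau} \<Longrightarrow> norm (f (k n) x - g x) < r / 2"
      using lim[of "r / 2"] by auto
    have "dist ((F \<circ> k) n) (clipfun tau g) < r" if "n \<ge> N" for n
    proof -
      have "dist (F (k n)) (clipfun tau g) \<le> r / 2"
      proof (rule dist_bound)
        fix x
        show "dist (F (k n) x) (clipfun tau g x) \<le> r / 2"
          using N[OF that clip_in[OF tau, of x]]
          by (simp add: f(3) clipfun_apply[OF f(1) L0 tau] clipfun_apply[OF gK L0 tau] dist_real_def)
      qed
      then show ?thesis using r by simp
    qed
    then show "\<exists>N. \<forall>n\<ge>N. dist ((F \<circ> k) n) (clipfun tau g) < r" by blast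
  qed
  ultimately show "\<exists>l\<in>clipfun tau ` {f \<in> Klam L tau. f 0 \<le> R}. \<exists>r. strict_mono r \<and> (F \<circ> r) \<longlonglongrightarrow> l"
    using gK k by blast
qed

section \<open>Consistency\<close>

locale cox_sample = cox_model M "X 0" "U 0" "T 0" "C 0" "\<lambda>t. lam0 (clip tau t)" b0 tau lo hi D
  for M :: "'a measure" and X U :: "nat \<Rightarrow> 'a \<Rightarrow> real^'m" and T C :: "nat \<Rightarrow> 'a \<Rightarrow> real"
    and lam0 :: "real \<Rightarrow> real" and b0 :: "real^'m" and tau lo hi D :: real +
  fixes L :: real and Theta :: "(real^'m) set"
  assumes iid_indep: "indep_vars (\<lambda>_. borel) (\<lambda>i w. (X i w, T i w, C i w, U i w)) UNIV"
    and iid_dist: "\<And>i. distr M borel (\<lambda>w. (X i w, T i w, C i w, U i w))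
                       = distr M borel (\<lambda>w. (X 0 w, T 0 w, C 0 w, U 0 w))"
    and C_range_all: "\<And>i w. w \<in> space M \<Longrightarrow> 0 \<le> C i w \<and> C i w \<le> tau"
    and L_pos: "0 < L" and lam0_K: "lam0 \<in> Klam L tau"
    and Theta_compact: "compact Theta" and norm_Theta: "\<And>b. b \<in> Theta \<Longrightarrow> norm b < D"
begin

abbreviation V :: "nat \<Rightarrow> 'a \<Rightarrow> (real^'m) \<times> real \<times> real \<times> (real^'m)" where
  "V i w \<equiv> (X i w, T i w, C i w, U i w)"

definition Q :: "nat \<Rightarrow> 'a \<Rightarrow> (real \<Rightarrow> real) \<times> (real^'m) \<Rightarrow> ereal" where
  "Q n w p = Qcor (mgf M (U 0)) n (\<lambda>i. observ (T i w) (C i w) (X i w) (U i w)) p"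

definition avg :: "((real^'m) \<times> real \<times> real \<times> (real^'m) \<Rightarrow> real) \<Rightarrow> nat \<Rightarrow> 'a \<Rightarrow> real" where
  "avg h n w = (\<Sum>i<n. h (V i w)) / real n"

lemma avg_tendsto:
  assumes "h \<in> borel_measurable borel" "integrable M (\<lambda>w. h (V 0 w))"
  shows "AE w in M. (\<lambda>n. avg h n w) \<longlonglongrightarrow> (\<integral>w. h (V 0 w) \<partial>M)"
  unfolding avg_def by (rule iid_strong_law[OF iid_indep iid_dist assms])

lemma measurable_V: "V i \<in> borel_measurable M"
  using iid_indep by (auto simp: indep_vars_def)

lemma AE_all_T_pos: "AE w in M. \<forall>i. 0 < T i w"
  unfolding AE_all_countable
proof
  fix i
  let ?P = "\<lambda>p :: (real^'m) \<times> real \<times> real \<times> (real^'m). 0 < fst (snd p)"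
  have P: "{p \<in> space borel. ?P p} \<in> sets borel"
    by (simp add: borel_prod[symmetric])
  have "AE p in distr M borel (V 0). ?P p"
    using AE_T_pos by (subst AE_distr_iff[OF measurable_V P]) simp
  then have "AE p in distr M borel (V i). ?P p" unfolding iid_dist[of i] .
  then show "AE w in M. 0 < T i w" by (subst (asm) AE_distr_iff[OF measurable_V P]) simp
qed

lemma Q_le_avg:
  assumes "\<And>i. qfun (mgf M (U 0)) (observ (T i w) (C i w) (X i w) (U i w)) p \<le> ereal (h (V i w))"
  shows "Q n w p \<le> ereal (avg h n w)"
proof -
  have "(\<Sum>i<n. qfun (mgf M (U 0)) (observ (T i w) (C i w) (X i w) (U i w)) p) \<le> (\<Sum>i<n. ereal (h (V i w)))"
    by (intro sum_mono assms)
  then have "Q n w p \<le> ereal (1 / real n) * ereal (\<Sum>i<n. h (V i w))"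
    unfolding Q_def Qcor_def by (intro ereal_mult_left_mono) auto
  then show ?thesis by (simp add: avg_def)
qed

lemma avg_add: "avg (\<lambda>v. h v + h' v) n w = avg h n w + avg h' n w"
  by (simp add: avg_def sum.distrib add_divide_distrib)

lemma Q_true:
  assumes "w \<in> space M" "\<And>i. 0 < T i w"
  shows "Q n w (lam0, b0) = ereal (avg qtrue n w)"
proof -
  have "qfun (mgf M (U 0)) (observ (T i w) (C i w) (X i w) (U i w)) (lam0, b0) = ereal (qtrue (V i w))" for i
    using C_range_all[OF assms(1)] assms(2) by (intro qfun_true) (auto simp: clip_id)
  then show ?thesis by (simp add: Q_def Qcor_def avg_def)
qed

lemma local_bound:
  assumes l: "continuous_on UNIV l" "\<And>s. 0 \<le> l s" "\<And>s. l s \<le> R" and b: "norm b < D"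
    and ne: "b \<noteq> b0 \<or> (\<exists>s\<in>{0..tau}. l s \<noteq> lam0 s)"
  obtains d \<gamma> where "0 < d" "0 < \<gamma>"
    "AE w in M. \<forall>\<^sub>F n in sequentially. \<forall>l' b'. l' \<in> Klam L tau \<longrightarrow> b' \<in> Theta
       \<longrightarrow> (\<forall>s\<in>{0..tau}. \<bar>l' s - l s\<bar> \<le> d) \<longrightarrow> norm (b' - b) \<le> d
       \<longrightarrow> Q n w (l', b') \<le> ereal (avg qtrue n w - \<gamma>)"
proof -
  have "b \<noteq> b0 \<or> (\<exists>s\<in>{0..tau}. l s \<noteq> lam0 (clip tau s))" using ne by (auto simp: clip_id)
  from exists_negative_excess[OF l b this] obtain d where d: "0 < d" "norm b + d \<le> D"
    and neg: "(\<integral>w. excess l b d (V 0 w) \<partial>M) < 0" by blast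
  define \<gamma> where "\<gamma> = - (\<integral>w. excess l b d (V 0 w) \<partial>M) / 2"
  have \<gamma>: "0 < \<gamma>" "(\<integral>w. excess l b d (V 0 w) \<partial>M) < - \<gamma>" using neg by (auto simp: \<gamma>_def)
  have "AE w in M. (\<lambda>n. avg (excess l b d) n w) \<longlonglongrightarrow> (\<integral>w. excess l b d (V 0 w) \<partial>M)"
    using d by (intro avg_tendsto measurable_excess integrable_excess[OF l b] l) auto
  moreover have "AE w in M. w \<in> space M" by simp
  ultimately have "AE w in M. \<forall>\<^sub>F n in sequentially. \<forall>l' b'. l' \<in> Klam L tau \<longrightarrow> b' \<in> Theta
       \<longrightarrow> (\<forall>s\<in>{0..tau}. \<bar>l' s - l s\<bar> \<le> d) \<longrightarrow> norm (b' - b) \<le> d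
       \<longrightarrow> Q n w (l', b') \<le> ereal (avg qtrue n w - \<gamma>)"
    using AE_all_T_pos
  proof eventually_elim
    case (elim w)
    from order_tendstoD(2)[OF elim(1) \<gamma>(2)] show ?case
    proof eventually_elim
      case n: (elim n)
      show ?case
      proof (intro allI impI)
        fix l' b' assume l': "l' \<in> Klam L tau" and b': "b' \<in> Theta"
          and close: "\<forall>s\<in>{0..tau}. \<bar>l' s - l s\<bar> \<le> d" "norm (b' - b) \<le> d"
        have "Q n w (l', b') \<le> ereal (avg (\<lambda>v. excess l b d v + qtrue v) n w)"
        proof (rule Q_le_avg)
          fix i
          show "qfun (mgf M (U 0)) (observ (T i w) (C i w) (X i w) (U i w)) (l', b')
              \<le> ereal (excess l b d (V i w) + qtrue (V i w))"
            using KlamD[OF l' less_imp_le[OF L_pos]] close d b norm_Theta[OF b'] elim C_range_all[of w i]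
            by (intro qfun_le_excess l) auto
        qed
        also have "\<dots> \<le> ereal (avg qtrue n w - \<gamma>)" using n by (simp add: avg_add)
        finally show "Q n w (l', b') \<le> ereal (avg qtrue n w - \<gamma>)" .
      qed
    qed
  qed
  with that d \<gamma> show thesis by blast
qed

definition at_risk :: "(real^'m) \<times> real \<times> real \<times> (real^'m) \<Rightarrow> real" where
  "at_risk = (\<lambda>(x, t, c, u). exp (- D * norm (x + u)) / mgfd 0 D * min t c)"

lemma qfun_le_large:
  assumes l: "l \<in> Klam L tau" "L * tau \<le> l 0" and b: "norm b < D" and a: "0 < a"
    and tc: "0 < t" "0 \<le> c" "c \<le> tau"
  shows "qfun (mgf M (U 0)) (observ t c x u) (l, b) \<le> ereal (l 0 * (a - at_risk (x, t, c, u))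
     + (a * L * tau + \<bar>ln a\<bar> + D * norm (x + u) + L * tau * at_risk (x, t, c, u)))"
proof -
  define y where "y = min t c"
  define W where "W = x + u"
  define k where "k = at_risk (x, t, c, u)"
  have y: "y \<in> {0..tau}" using tc by (auto simp: y_def)
  note K = KlamD[OF l(1) less_imp_le[OF L_pos]]
  have bW: "\<bar>b \<bullet> W\<bar> \<le> D * norm W"
    using Cauchy_Schwarz_ineq2[of b W] mult_right_mono[OF less_imp_le[OF b] norm_ge_zero[of W]] by linarith
  have m: "0 < mgf M (U 0) b" "mgf M (U 0) b \<le> mgfd 0 D"
    using mgf_pos[OF b] mgf_le_mgfd[of 0 D b] b by auto
  have i: "l integrable_on {0..y}"
    using y by (intro integrable_continuous_real continuous_on_subset[OF K(2)]) auto
  have "(l 0 - L * tau) * y = integral {0..y} (\<lambda>_. l 0 - L * tau)" using y by simp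
  also have "\<dots> \<le> integral {0..y} l"
  proof (rule integral_le)
    fix s assume "s \<in> {0..y}"
    with K(3)[of s] y show "l 0 - L * tau \<le> l s" by (auto simp: abs_le_iff)
  qed (use i in auto)
  finally have I: "(l 0 - L * tau) * y \<le> integral {0..y} l" .
  have "(l 0 - L * tau) * k = exp (- D * norm W) / mgfd 0 D * ((l 0 - L * tau) * y)"
    by (simp add: k_def at_risk_def W_def y_def)
  also have "\<dots> \<le> exp (b \<bullet> W) / mgf M (U 0) b * integral {0..y} l"
    using m I bW l(2) y by (intro mult_mono frac_le) (auto simp: abs_le_iff)
  finally have second: "(l 0 - L * tau) * k \<le> exp (b \<bullet> W) / mgf M (U 0) b * integral {0..y} l" .
  define F where "F = a * (l 0 + L * tau) + \<bar>ln a\<bar> + D * norm W"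
  have "0 \<le> l 0 + L * tau" using l(2) mult_pos_pos[OF L_pos tau_pos] by linarith
  then have F0: "0 \<le> F" using a D_pos by (simp add: F_def)
  have first: "ln (l y) + b \<bullet> W \<le> F" if "0 < l y"
  proof -
    have "ln (a * l y) \<le> a * l y - 1" using a that by (intro ln_le_minus_one) auto
    then have "ln (l y) \<le> a * l y - ln a" using a that by (simp add: ln_mult)
    moreover have "a * l y \<le> a * (l 0 + L * tau)"
      using K(3)[OF y] a by (intro mult_left_mono) (auto simp: abs_le_iff)
    moreover have "- ln a \<le> \<bar>ln a\<bar>" by simp
    ultimately show ?thesis using bW unfolding F_def by linarith
  qed
  have rhs: "l 0 * (a - k) + (a * L * tau + \<bar>ln a\<bar> + D * norm W + L * tau * k) = F - (l 0 - L * tau) * k"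
    by (simp add: F_def algebra_simps)
  show ?thesis
    unfolding W_def[symmetric] k_def[symmetric] rhs
  proof (cases "t \<le> c \<and> l y = 0")
    case True
    then show "qfun (mgf M (U 0)) (observ t c x u) (l, b) \<le> ereal (F - (l 0 - L * tau) * k)"
      by (auto simp: qfun_def observ_def y_def min_def)
  next
    case False
    have "qfun (mgf M (U 0)) (observ t c x u) (l, b)
      = ereal (of_bool (t \<le> c) * (ln (l y) + b \<bullet> W) - exp (b \<bullet> W) / mgf M (U 0) b * integral {0..y} l)"
      using False by (auto simp: qfun_def observ_def y_def W_def)
    moreover have "of_bool (t \<le> c) * (ln (l y) + b \<bullet> W) \<le> F"
      using False first F0 K(1)[OF y] by (cases "t \<le> c") auto
    ultimately show "qfun (mgf M (U 0)) (observ t c x u) (l, b) \<le> ereal (F - (l 0 - L * tau) * k)"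
      using second by simp
  qed
qed

lemma measurable_at_risk [measurable]: "at_risk \<in> borel_measurable borel"
proof -
  have "at_risk \<in> borel_measurable (borel \<Otimes>\<^sub>M borel \<Otimes>\<^sub>M borel \<Otimes>\<^sub>M borel)"
    unfolding at_risk_def by measurable
  then show ?thesis by (simp add: borel_prod)
qed

lemma mgfd_0_D_pos: "0 < mgfd 0 D"
  using mgf_pos[OF norm_b0] mgf_le_mgfd[of 0 D b0] norm_b0 by simp

lemma integrable_at_risk: "integrable M (\<lambda>w. at_risk (V 0 w))"
  and integral_at_risk_pos: "0 < (\<integral>w. at_risk (V 0 w) \<partial>M)"
proof -
  have nonneg: "AE w in M. 0 \<le> at_risk (V 0 w)"
    using AE_Y_range by eventually_elim (use mgfd_0_D_pos in \<open>auto simp: at_risk_def\<close>)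
  show int: "integrable M (\<lambda>w. at_risk (V 0 w))"
  proof (rule integrable_const_bound[where B = "1 / mgfd 0 D * tau"])
    show "AE w in M. norm (at_risk (V 0 w)) \<le> 1 / mgfd 0 D * tau"
      using AE_Y_range nonneg
    proof eventually_elim
      case (elim w)
      have "at_risk (V 0 w) \<le> 1 / mgfd 0 D * tau"
        unfolding at_risk_def prod.case
        using elim(1) mgfd_0_D_pos D_pos by (intro mult_mono divide_right_mono) auto
      with elim(2) show ?case by simp
    qed
    show "(\<lambda>w. at_risk (V 0 w)) \<in> borel_measurable M"
      by (rule measurable_compose[OF measurable_V measurable_at_risk])
  qed
  have "(\<integral>w. at_risk (V 0 w) \<partial>M) \<noteq> 0"
  proof
    assume "(\<integral>w. at_risk (V 0 w) \<partial>M) = 0"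
    then have "AE w in M. at_risk (V 0 w) = 0"
      using integral_nonneg_eq_0_iff_AE[OF int nonneg] by simp
    then obtain w where "w \<in> {w \<in> space M. 0 < T 0 w \<and> 0 < C 0 w}" "at_risk (V 0 w) = 0"
      using AE_prob_pos_obtain[OF _ prob_T_C_gt[of 0]] tau_pos by auto
    then show False using mgfd_0_D_pos by (auto simp: at_risk_def min_def split: if_splits)
  qed
  moreover have "0 \<le> (\<integral>w. at_risk (V 0 w) \<partial>M)" using nonneg by (rule integral_nonneg_AE)
  ultimately show "0 < (\<integral>w. at_risk (V 0 w) \<partial>M)" by simp
qed

lemma norm_W_le_envelope: "D * norm (X 0 w + U 0 w) \<le> 2 * envelope w"
proof -
  have "D * norm (X 0 w + U 0 w) \<le> D * norm (X 0 w) + D * norm (U 0 w)"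
    using mult_left_mono[OF norm_triangle_ineq[of "X 0 w" "U 0 w"] less_imp_le[OF D_pos]]
    by (simp add: distrib_left)
  then show ?thesis using envelope_ge(4,5)[of w] by linarith
qed

lemma measurable_qtrue [measurable]: "qtrue \<in> borel_measurable borel"
proof -
  note [measurable (raw)] = measurable_compose[OF _ borel_l0] 
    measurable_compose[OF _ borel_measurable_integral_atLeast0[OF l0_cont]]
  have "qtrue \<in> borel_measurable (borel \<Otimes>\<^sub>M borel \<Otimes>\<^sub>M borel \<Otimes>\<^sub>M borel)"
    unfolding qtrue_def by measurable
  then show ?thesis by (simp add: borel_prod)
qed

lemma integrable_qtrue: "integrable M (\<lambda>w. qtrue (V 0 w))"
proof (rule Bochner_Integration.integrable_bound[OF integrable_mult_right[OF integrable_envelope]])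
  let ?l0 = "\<lambda>t. lam0 (clip tau t)"
  let ?K = "\<bar>ln lo\<bar> + \<bar>ln hi\<bar> + 2 + hi * tau / mgf M (U 0) b0"
  show "(\<lambda>w. qtrue (V 0 w)) \<in> borel_measurable M"
    by (rule measurable_compose[OF measurable_V measurable_qtrue])
  show "AE w in M. norm (qtrue (V 0 w)) \<le> norm (?K * envelope w)"
    using AE_Y_range
  proof eventually_elim
    case (elim w)
    define y where "y = min (T 0 w) (C 0 w)"
    have m: "0 < mgf M (U 0) b0" by (rule mgf_pos[OF norm_b0])
    have e: "1 \<le> envelope w" by (rule envelope_ge)
    have "ln lo \<le> ln (?l0 y)" "ln (?l0 y) \<le> ln hi"
      using lo_pos l0_lower[of y] l0_upper[of y] l0_pos[of y] by simp_all
    then have "\<bar>ln (?l0 y)\<bar> \<le> \<bar>ln lo\<bar> + \<bar>ln hi\<bar>" by linarith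
    also have "\<dots> = (\<bar>ln lo\<bar> + \<bar>ln hi\<bar>) * 1" by simp
    also have "\<dots> \<le> (\<bar>ln lo\<bar> + \<bar>ln hi\<bar>) * envelope w" using e by (intro mult_left_mono) auto
    finally have 1: "\<bar>ln (?l0 y)\<bar> \<le> (\<bar>ln lo\<bar> + \<bar>ln hi\<bar>) * envelope w" .
    have "\<bar>b0 \<bullet> (X 0 w + U 0 w)\<bar> \<le> norm b0 * norm (X 0 w + U 0 w)" by (rule Cauchy_Schwarz_ineq2)
    also have "\<dots> \<le> D * norm (X 0 w + U 0 w)" using norm_b0 by (intro mult_right_mono) auto
    finally have 2: "\<bar>b0 \<bullet> (X 0 w + U 0 w)\<bar> \<le> 2 * envelope w" using norm_W_le_envelope[of w] by linarith
    have I: "0 \<le> integral {0..y} ?l0" "integral {0..y} ?l0 \<le> hi * tau"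
      using integral_0_bounds[OF l0_cont less_imp_le[OF l0_pos] l0_upper] elim by (auto simp: y_def)
    have "\<bar>exp (b0 \<bullet> (X 0 w + U 0 w)) / mgf M (U 0) b0 * integral {0..y} ?l0\<bar>
      = exp (b0 \<bullet> (X 0 w + U 0 w)) / mgf M (U 0) b0 * integral {0..y} ?l0" using m I by simp
    also have "\<dots> \<le> envelope w / mgf M (U 0) b0 * (hi * tau)"
      using m I e exp_inner_W_le_envelope[OF less_imp_le[OF norm_b0], of w]
      by (intro mult_mono divide_right_mono) auto
    finally have 3: "\<bar>exp (b0 \<bullet> (X 0 w + U 0 w)) / mgf M (U 0) b0 * integral {0..y} ?l0\<bar>
        \<le> hi * tau / mgf M (U 0) b0 * envelope w" by (simp add: mult_ac)
    have "\<bar>qtrue (V 0 w)\<bar> \<le> \<bar>ln (?l0 y)\<bar> + \<bar>b0 \<bullet> (X 0 w + U 0 w)\<bar>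
       + \<bar>exp (b0 \<bullet> (X 0 w + U 0 w)) / mgf M (U 0) b0 * integral {0..y} ?l0\<bar>"
    proof -
      have "\<bar>of_bool e * (p + q) - r\<bar> \<le> \<bar>p\<bar> + \<bar>q\<bar> + \<bar>r\<bar>" for e and p q r :: real
        by (cases e) auto
      then show ?thesis unfolding qtrue_def prod.case y_def by blast
    qed
    also have "\<dots> \<le> (\<bar>ln lo\<bar> + \<bar>ln hi\<bar>) * envelope w + 2 * envelope w + hi * tau / mgf M (U 0) b0 * envelope w"
      by (intro add_mono 1 2 3)
    also have "\<dots> = ?K * envelope w" by (simp only: distrib_right)
    also have "\<dots> \<le> \<bar>?K * envelope w\<bar>" by (rule abs_ge_self)
    finally show ?case by (simp only: real_norm_def)
  qed
qed

lemma far_bound: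
  obtains R where "AE w in M. \<forall>\<^sub>F n in sequentially. \<forall>l b. l \<in> Klam L tau \<longrightarrow> b \<in> Theta \<longrightarrow> R < l 0
       \<longrightarrow> Q n w (l, b) \<le> ereal (avg qtrue n w - 1)"
proof -
  define \<kappa> where "\<kappa> = (\<integral>w. at_risk (V 0 w) \<partial>M)"
  have \<kappa>: "0 < \<kappa>" using integral_at_risk_pos by (simp add: \<kappa>_def)
  define a where "a = \<kappa> / 2"
  define h where "h = (\<lambda>v. a - at_risk v)"
  define g where "g = (\<lambda>v. a * L * tau + \<bar>ln a\<bar> + D * norm (fst v + snd (snd (snd v))) + L * tau * at_risk v)"
  have h: "h \<in> borel_measurable borel" unfolding h_def by measurable
  have h_int: "integrable M (\<lambda>w. h (V 0 w))" unfolding h_def using integrable_at_risk by simp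
  have h_exp: "(\<integral>w. h (V 0 w) \<partial>M) < - (\<kappa> / 4)"
    unfolding h_def using integrable_at_risk \<kappa> by (simp add: prob_space \<kappa>_def[symmetric] a_def)
  have g: "g \<in> borel_measurable borel"
  proof -
    have "(\<lambda>v :: (real^'m) \<times> real \<times> real \<times> (real^'m). norm (fst v + snd (snd (snd v)))) \<in> borel_measurable borel"
      by (intro borel_measurable_continuous_onI continuous_intros)
    then show ?thesis unfolding g_def by measurable
  qed
  have W_int: "integrable M (\<lambda>w. D * norm (X 0 w + U 0 w))"
  proof (rule Bochner_Integration.integrable_bound[OF integrable_mult_right[OF integrable_envelope, of 2]])
    show "AE w in M. norm (D * norm (X 0 w + U 0 w)) \<le> norm (2 * envelope w)"
      using norm_W_le_envelope D_pos by (intro AE_I2) (simp, smt (verit) envelope_ge(1))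
  qed measurable
  have g_int: "integrable M (\<lambda>w. g (V 0 w))"
    unfolding g_def using W_int integrable_at_risk by simp
  define c1 where "c1 = (\<integral>w. g (V 0 w) \<partial>M)"
  define c2 where "c2 = (\<integral>w. qtrue (V 0 w) \<partial>M)"
  define R where "R = max (L * tau) (4 * (c1 + 3 - c2) / \<kappa>)"
  have "AE w in M. w \<in> space M" by simp
  with avg_tendsto[OF h h_int] avg_tendsto[OF g g_int] avg_tendsto[OF measurable_qtrue integrable_qtrue] AE_all_T_pos
  have "AE w in M. \<forall>\<^sub>F n in sequentially. \<forall>l b. l \<in> Klam L tau \<longrightarrow> b \<in> Theta \<longrightarrow> R < l 0
       \<longrightarrow> Q n w (l, b) \<le> ereal (avg qtrue n w - 1)"
  proof eventually_elim
    case (elim w)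
    have "\<forall>\<^sub>F n in sequentially. avg g n w < c1 + 1"
      using order_tendstoD(2)[OF elim(2)] by (simp add: c1_def)
    moreover have "\<forall>\<^sub>F n in sequentially. c2 - 1 < avg qtrue n w"
      using order_tendstoD(1)[OF elim(3)] by (simp add: c2_def)
    ultimately show ?case
      using order_tendstoD(2)[OF elim(1) h_exp]
    proof eventually_elim
      case n: (elim n)
      show ?case
      proof (intro allI impI)
        fix l b assume l: "l \<in> Klam L tau" and b: "b \<in> Theta" and R: "R < l 0"
        have lt: "L * tau \<le> l 0" "4 * (c1 + 3 - c2) / \<kappa> < l 0" using R by (auto simp: R_def)
        have pos: "0 < l 0" using lt(1) R mult_pos_pos[OF L_pos tau_pos] by linarith
        have "Q n w (l, b) \<le> ereal (avg (\<lambda>v. l 0 * h v + g v) n w)"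
        proof (rule Q_le_avg)
          fix i
          show "qfun (mgf M (U 0)) (observ (T i w) (C i w) (X i w) (U i w)) (l, b)
            \<le> ereal (l 0 * h (V i w) + g (V i w))"
            using qfun_le_large[OF l lt(1) norm_Theta[OF b], of a "T i w" "C i w" "X i w" "U i w"]
              \<kappa> elim C_range_all[of w i] by (simp add: h_def g_def a_def)
        qed
        also have "avg (\<lambda>v. l 0 * h v + g v) n w = l 0 * avg h n w + avg g n w"
          by (simp add: avg_def sum.distrib add_divide_distrib sum_distrib_left[symmetric])
        also have "\<dots> \<le> l 0 * (- (\<kappa> / 4)) + (c1 + 1)"
          using n pos by (intro add_mono mult_left_mono) auto
        also have "\<dots> \<le> (c2 - 1) - 1"
          using lt(2) \<kappa> by (simp add: field_simps)
        also have "\<dots> \<le> avg qtrue n w - 1" using n by simp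
        finally show "Q n w (l, b) \<le> ereal (avg qtrue n w - 1)" by simp
      qed
    qed
  qed
  with that show thesis by blast
qed

lemma eventually_close:
  assumes \<rho>: "0 < \<rho>" and eps: "eps \<longlonglongrightarrow> 0"
  shows "AE w in M. \<forall>\<^sub>F n in sequentially. \<forall>l b. l \<in> Klam L tau \<longrightarrow> b \<in> Theta
     \<longrightarrow> ereal (avg qtrue n w - eps n) \<le> Q n w (l, b)
     \<longrightarrow> dist (clipfun tau l, b) (clipfun tau lam0, b0) < \<rho>"
proof -
  obtain R where R: "AE w in M. \<forall>\<^sub>F n in sequentially. \<forall>l b. l \<in> Klam L tau \<longrightarrow> b \<in> Theta \<longrightarrow> R < l 0
       \<longrightarrow> Q n w (l, b) \<le> ereal (avg qtrue n w - 1)" by (rule far_bound)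
  have L0: "0 \<le> L" and tau0: "0 \<le> tau" using L_pos tau_pos by auto
  note ap = clipfun_apply[OF _ L0 tau0]
  define S where "S = clipfun tau ` {f \<in> Klam L tau. f 0 \<le> R} \<times> Theta - ball (clipfun tau lam0, b0) \<rho>"
  have S: "compact S"
    unfolding S_def by (intro compact_diff compact_Times compact_clipfun_Klam Theta_compact L_pos tau0 open_ball)
  define good where "good = (\<lambda>p d \<gamma>. AE w in M. \<forall>\<^sub>F n in sequentially. \<forall>l' b'. l' \<in> Klam L tau \<longrightarrow> b' \<in> Theta
       \<longrightarrow> (\<forall>s\<in>{0..tau}. \<bar>l' s - apply_bcontfun (fst p) s\<bar> \<le> d) \<longrightarrow> norm (b' - snd p) \<le> d
       \<longrightarrow> Q n w (l', b') \<le> ereal (avg qtrue n w - \<gamma>))"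
  have "\<exists>d \<gamma>. 0 < d \<and> 0 < \<gamma> \<and> good p d \<gamma>" if p: "p \<in> S" for p
  proof -
    from p obtain f b where f: "f \<in> Klam L tau" "f 0 \<le> R" and b: "b \<in> Theta" and pe: "p = (clipfun tau f, b)"
      and far: "\<rho> \<le> dist p (clipfun tau lam0, b0)"
      by (auto simp: S_def dist_commute)
    let ?l = "apply_bcontfun (clipfun tau f)"
    note K = KlamD[OF f(1) L0]
    have l: "continuous_on UNIV ?l" by simp
    have l': "0 \<le> ?l s" "?l s \<le> R + L * tau" for s
      using K(1,3)[OF clip_in[OF tau0, of s]] f(2) by (simp_all add: ap[OF f(1)])
    have ne: "b \<noteq> b0 \<or> (\<exists>s\<in>{0..tau}. ?l s \<noteq> lam0 s)"
    proof (rule ccontr)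
      assume "\<not> (b \<noteq> b0 \<or> (\<exists>s\<in>{0..tau}. ?l s \<noteq> lam0 s))"
      then have "b = b0" and eq: "\<And>s. s \<in> {0..tau} \<Longrightarrow> f s = lam0 s"
        by (auto simp: ap[OF f(1)] clip_id)
      moreover have "clipfun tau f = clipfun tau lam0"
        by (rule bcontfun_eqI) (simp add: ap[OF f(1)] ap[OF lam0_K] eq[OF clip_in[OF tau0]])
      ultimately show False using far \<rho> by (simp add: pe)
    qed
    show ?thesis
    proof (rule local_bound[OF l l' norm_Theta[OF b] ne], goal_cases)
      case (1 d \<gamma>)
      then show ?case
        by (intro exI[of _ d] exI[of _ \<gamma>]) (simp only: good_def pe fst_conv snd_conv simp_thms)
    qed
  qed
  then obtain d \<gamma> where d: "\<And>p. p \<in> S \<Longrightarrow> 0 < d p" and \<gamma>: "\<And>p. p \<in> S \<Longrightarrow> 0 < \<gamma> p"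
    and gd: "\<And>p. p \<in> S \<Longrightarrow> good p (d p) (\<gamma> p)" by metis
  obtain S' where S': "S' \<subseteq> S" "finite S'" "S \<subseteq> (\<Union>p\<in>S'. ball p (d p))"
    by (rule compactE_image[OF S, of S "\<lambda>p. ball p (d p)"]) (use d in auto)
  have "AE w in M. \<forall>p\<in>S'. \<forall>\<^sub>F n in sequentially. \<forall>l' b'. l' \<in> Klam L tau \<longrightarrow> b' \<in> Theta
       \<longrightarrow> (\<forall>s\<in>{0..tau}. \<bar>l' s - apply_bcontfun (fst p) s\<bar> \<le> d p) \<longrightarrow> norm (b' - snd p) \<le> d p
       \<longrightarrow> Q n w (l', b') \<le> ereal (avg qtrue n w - \<gamma> p)"
    using gd S' unfolding good_def by (intro AE_finite_allI) auto
  with R show ?thesis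
  proof eventually_elim
    case (elim w)
    have "\<forall>\<^sub>F n in sequentially. \<forall>p\<in>S'. (\<forall>l' b'. l' \<in> Klam L tau \<longrightarrow> b' \<in> Theta
       \<longrightarrow> (\<forall>s\<in>{0..tau}. \<bar>l' s - apply_bcontfun (fst p) s\<bar> \<le> d p) \<longrightarrow> norm (b' - snd p) \<le> d p
       \<longrightarrow> Q n w (l', b') \<le> ereal (avg qtrue n w - \<gamma> p))"
      using S'(2) elim(2) by (simp add: eventually_ball_finite_distrib)
    moreover have "\<forall>\<^sub>F n in sequentially. \<forall>p\<in>S'. eps n < \<gamma> p"
      using S' \<gamma> order_tendstoD(2)[OF eps] by (auto simp: eventually_ball_finite_distrib)
    moreover have "\<forall>\<^sub>F n in sequentially. eps n < 1" using order_tendstoD(2)[OF eps] by auto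
    ultimately show ?case using elim(1)
    proof eventually_elim
      case n: (elim n)
      show ?case
      proof (intro allI impI)
        fix l b assume l: "l \<in> Klam L tau" and b: "b \<in> Theta"
          and Q: "ereal (avg qtrue n w - eps n) \<le> Q n w (l, b)"
        show "dist (clipfun tau l, b) (clipfun tau lam0, b0) < \<rho>"
        proof (rule ccontr)
          assume far: "\<not> dist (clipfun tau l, b) (clipfun tau lam0, b0) < \<rho>"
          have "l 0 \<le> R"
          proof (rule ccontr)
            assume "\<not> l 0 \<le> R"
            then have "Q n w (l, b) \<le> ereal (avg qtrue n w - 1)" using n(4) l b by auto
            with Q have "ereal (avg qtrue n w - eps n) \<le> ereal (avg qtrue n w - 1)" by (rule order_trans)
            with n(3) show False by simp
          qed
          then have "(clipfun tau l, b) \<in> S" using l b far by (auto simp: S_def dist_commute)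
          then obtain p where p: "p \<in> S'" "dist p (clipfun tau l, b) < d p" using S'(3) by auto
          have "\<bar>l s - apply_bcontfun (fst p) s\<bar> \<le> d p" if s: "s \<in> {0..tau}" for s
          proof -
            have "dist (apply_bcontfun (fst p) s) (apply_bcontfun (clipfun tau l) s) \<le> dist (fst p) (clipfun tau l)"
              by (rule dist_bounded)
            also have "\<dots> \<le> dist p (clipfun tau l, b)" using dist_fst_le[of p "(clipfun tau l, b)"] by simp
            finally show ?thesis using p(2) by (simp add: ap[OF l] clip_id[OF s] dist_real_def)
          qed
          moreover have "norm (b - snd p) \<le> d p"
            using dist_snd_le[of p "(clipfun tau l, b)"] p(2) by (simp add: dist_norm norm_minus_commute)
          ultimately have "Q n w (l, b) \<le> ereal (avg qtrue n w - \<gamma> p)" using n(1) p(1) l b by blast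
          with Q have "ereal (avg qtrue n w - eps n) \<le> ereal (avg qtrue n w - \<gamma> p)" by (rule order_trans)
          with n(2) p(1) show False by auto
        qed
      qed
    qed
  qed
qed

lemma consistency:
  assumes eps: "eps \<longlonglongrightarrow> 0"
    and est_K: "\<And>n w. est n w \<in> Klam L tau \<times> Theta"
    and approx: "\<And>n. AE w in M. Q n w (est n w) \<ge> (SUP p \<in> Klam L tau \<times> Theta. Q n w p) - ereal (eps n)"
    and b0: "b0 \<in> Theta"
  shows "AE w in M. (\<lambda>n. SUP t\<in>{0..tau}. \<bar>fst (est n w) t - lam0 t\<bar>) \<longlonglongrightarrow> 0
     \<and> (\<lambda>n. snd (est n w)) \<longlonglongrightarrow> b0"
proof -
  have L0: "0 \<le> L" and tau0: "0 \<le> tau" using L_pos tau_pos by auto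
  note ap = clipfun_apply[OF _ L0 tau0]
  have "AE w in M. \<forall>k. \<forall>\<^sub>F n in sequentially. \<forall>l b. l \<in> Klam L tau \<longrightarrow> b \<in> Theta
     \<longrightarrow> ereal (avg qtrue n w - eps n) \<le> Q n w (l, b)
     \<longrightarrow> dist (clipfun tau l, b) (clipfun tau lam0, b0) < 1 / real (Suc k)"
    unfolding AE_all_countable by (intro allI eventually_close eps) simp
  moreover have "AE w in M. \<forall>n. Q n w (est n w) \<ge> (SUP p \<in> Klam L tau \<times> Theta. Q n w p) - ereal (eps n)"
    unfolding AE_all_countable using approx by blast
  moreover have "AE w in M. w \<in> space M" by simp
  ultimately show ?thesis using AE_all_T_pos
  proof eventually_elim
    case (elim w)
    define P where "P n = (clipfun tau (fst (est n w)), snd (est n w))" for n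
    have ge: "ereal (avg qtrue n w - eps n) \<le> Q n w (fst (est n w), snd (est n w))" for n
    proof -
      have "Q n w (lam0, b0) \<le> (SUP p \<in> Klam L tau \<times> Theta. Q n w p)"
        using lam0_K b0 by (intro SUP_upper) auto
      then have "Q n w (lam0, b0) - ereal (eps n) \<le> (SUP p \<in> Klam L tau \<times> Theta. Q n w p) - ereal (eps n)"
        by (intro ereal_minus_mono) auto
      also have "\<dots> \<le> Q n w (est n w)" using elim(2) by blast
      finally show ?thesis using Q_true[of w n] elim by simp
    qed
    have K: "fst (est n w) \<in> Klam L tau" "snd (est n w) \<in> Theta" for n
      using est_K[of n w] by (auto simp: mem_Times_iff)
    have P: "P \<longlonglongrightarrow> (clipfun tau lam0, b0)"
    proof (rule tendstoI)
      fix r :: real assume "0 < r"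
      then obtain k where k: "1 / real (Suc k) < r" using nat_approx_posE by blast
      from elim(1)[rule_format, of k] show "\<forall>\<^sub>F n in sequentially. dist (P n) (clipfun tau lam0, b0) < r"
      proof eventually_elim
        case (elim n)
        have "dist (P n) (clipfun tau lam0, b0) < 1 / real (Suc k)"
          unfolding P_def using elim K ge by blast
        with k show ?case by linarith
      qed
    qed
    have "(\<lambda>n. snd (P n)) \<longlonglongrightarrow> b0" using tendsto_snd[OF P] by simp
    moreover have "(\<lambda>n. SUP t\<in>{0..tau}. \<bar>fst (est n w) t - lam0 t\<bar>) \<longlonglongrightarrow> 0"
    proof (rule tendsto_sandwich[OF _ _ tendsto_const])
      have le: "\<bar>fst (est n w) t - lam0 t\<bar> \<le> dist (P n) (clipfun tau lam0, b0)" if t: "t \<in> {0..tau}" for n t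
      proof -
        have "dist (apply_bcontfun (fst (P n)) t) (apply_bcontfun (clipfun tau lam0) t) \<le> dist (fst (P n)) (clipfun tau lam0)"
          by (rule dist_bounded)
        also have "\<dots> \<le> dist (P n) (clipfun tau lam0, b0)"
          using dist_fst_le[of "P n" "(clipfun tau lam0, b0)"] by simp
        finally show ?thesis by (simp add: P_def ap[OF K(1)] ap[OF lam0_K] clip_id[OF t] dist_real_def)
      qed
      show "\<forall>\<^sub>F n in sequentially. (SUP t\<in>{0..tau}. \<bar>fst (est n w) t - lam0 t\<bar>) \<le> dist (P n) (clipfun tau lam0, b0)"
        using le tau0 by (intro always_eventually allI cSUP_least) auto
      show "\<forall>\<^sub>F n in sequentially. 0 \<le> (SUP t\<in>{0..tau}. \<bar>fst (est n w) t - lam0 t\<bar>)"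
      proof (intro always_eventually allI)
        fix n
        have "bdd_above ((\<lambda>t. \<bar>fst (est n w) t - lam0 t\<bar>) ` {0..tau})" using le[of _ n] by (intro bdd_aboveI2) auto
        then show "0 \<le> (SUP t\<in>{0..tau}. \<bar>fst (est n w) t - lam0 t\<bar>)"
          by (rule cSUP_upper2[of _ _ 0]) (use tau0 in auto)
      qed
      show "(\<lambda>n. dist (P n) (clipfun tau lam0, b0)) \<longlonglongrightarrow> 0"
        using P by (simp add: tendsto_dist_iff[symmetric])
    qed
    ultimately show ?case by (simp add: P_def)
  qed
qed

end

theorem theorem1:
  fixes M :: "'a measure"
    and X U :: "nat \<Rightarrow> 'a \<Rightarrow> real^'m"
    and T C :: "nat \<Rightarrow> 'a \<Rightarrow> real"
    and lam0 :: "real \<Rightarrow> real" and beta0 :: "real^'m"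
    and tau L :: real and Theta :: "(real^'m) set"
    and eps :: "nat \<Rightarrow> real" and eps0 :: real
    and est :: "nat \<Rightarrow> (nat \<Rightarrow> real \<times> bool \<times> (real^'m)) \<Rightarrow> (real \<Rightarrow> real) \<times> (real^'m)"
  assumes P: "prob_space M"
    and meas: "\<And>i. X i \<in> borel_measurable M" "\<And>i. U i \<in> borel_measurable M"
      "\<And>i. T i \<in> borel_measurable M" "\<And>i. C i \<in> borel_measurable M"
    \<comment> \<open>i.i.d. copies (X_i,T_i,C_i,U_i)\<close>
    and iid_indep: "prob_space.indep_vars M (\<lambda>_. borel)
                      (\<lambda>i w. (X i w, T i w, C i w, U i w)) UNIV"
    and iid_dist: "\<And>i. distr M borel (\<lambda>w. (X i w, T i w, C i w, U i w))
                       = distr M borel (\<lambda>w. (X 0 w, T 0 w, C 0 w, U 0 w))"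
    \<comment> \<open>(T,X), C and U mutually independent\<close>
    and indep3: "\<And>i (A :: (real \<times> (real^'m)) set) (B :: real set) (D :: (real^'m) set).
       A \<in> sets borel \<Longrightarrow> B \<in> sets borel \<Longrightarrow> D \<in> sets borel \<Longrightarrow>
       measure M {w \<in> space M. (T i w, X i w) \<in> A \<and> C i w \<in> B \<and> U i w \<in> D}
       = measure M {w \<in> space M. (T i w, X i w) \<in> A} * measure M {w \<in> space M. C i w \<in> B}
         * measure M {w \<in> space M. U i w \<in> D}"
    \<comment> \<open>Cox model: conditional hazard lam0(t) exp(beta0' X), i.e. conditional
        survival exp(-exp(beta0' X) int_0^t lam0) on [0,tau]\<close>
    and cox: "\<And>i A t. A \<in> sets borel \<Longrightarrow> t \<in> {0..tau} \<Longrightarrow>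
       measure M {w \<in> space M. X i w \<in> A \<and> T i w > t}
       = integral\<^sup>L M (\<lambda>w. indicator A (X i w) * exp (- exp (beta0 \<bullet> X i w) * integral {0..t} lam0))"
    and tau_pos: "0 < tau"
    and C_range: "\<And>i w. w \<in> space M \<Longrightarrow> 0 \<le> C i w \<and> C i w \<le> tau"
    \<comment> \<open>(i)\<close>
    and L_pos: "0 < L"
    \<comment> \<open>(ii)\<close>
    and Theta_compact: "compact Theta"
    \<comment> \<open>(iii)\<close>
    and U_mean: "integral\<^sup>L M (U 0) = 0"
    and eps0: "0 < eps0"
    and U_mom: "integrable M (\<lambda>w. exp (((SUP b\<in>Theta. norm b) + eps0) * norm (U 0 w)))"
    \<comment> \<open>(iv)\<close>
    and X_mom: "integrable M (\<lambda>w. exp (((SUP b\<in>Theta. norm b) + eps0) * norm (X 0 w)))"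
    \<comment> \<open>(v)\<close>
    and C_tau: "measure M {w \<in> space M. C 0 w > tau} = 0"
    and C_pos: "\<And>e. e > 0 \<Longrightarrow> measure M {w \<in> space M. C 0 w > tau - e} > 0"
    \<comment> \<open>(vi)\<close>
    and cov_pd: "pos_def_matrix (cov_matrix M (X 0))"
    \<comment> \<open>(vii)\<close>
    and true_in_K: "lam0 \<in> Klam L tau" "beta0 \<in> Theta"
    and lam0_pos: "\<And>t. t \<in> {0..tau} \<Longrightarrow> lam0 t > 0"
    \<comment> \<open>eps_n decreasing to 0, positive\<close>
    and eps_pos: "\<And>n. eps n > 0" and eps_dec: "decseq eps" and eps_lim: "eps \<longlonglongrightarrow> 0"
    \<comment> \<open>estimator: Borel function of the first n observations with values in K\<close>
    and est_K: "\<And>n z. est n z \<in> Klam L tau \<times> Theta"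
    and est_first_n: "\<And>n z z'. (\<And>i. i < n \<Longrightarrow> z i = z' i) \<Longrightarrow> est n z = est n z'"
    and est_meas_lam: "\<And>n t. t \<in> {0..tau} \<Longrightarrow> (\<lambda>z. fst (est n z) t)
        \<in> borel_measurable (PiM UNIV (\<lambda>_::nat. borel \<Otimes>\<^sub>M count_space UNIV \<Otimes>\<^sub>M borel))"
    and est_meas_beta: "\<And>n. (\<lambda>z. snd (est n z))
        \<in> borel_measurable (PiM UNIV (\<lambda>_::nat. borel \<Otimes>\<^sub>M count_space UNIV \<Otimes>\<^sub>M borel))"
    \<comment> \<open>approximate maximizer of Q_n^cor over K\<close>
    and est_approx: "\<And>n. AE w in M.
        Qcor (mgf M (U 0)) n (\<lambda>i. observ (T i w) (C i w) (X i w) (U i w))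
             (est n (\<lambda>i. observ (T i w) (C i w) (X i w) (U i w)))
        \<ge> (SUP p \<in> Klam L tau \<times> Theta.
             Qcor (mgf M (U 0)) n (\<lambda>i. observ (T i w) (C i w) (X i w) (U i w)) p) - ereal (eps n)"
  shows "AE w in M.
     (\<lambda>n. SUP t\<in>{0..tau}. \<bar>fst (est n (\<lambda>i. observ (T i w) (C i w) (X i w) (U i w))) t - lam0 t\<bar>)
        \<longlonglongrightarrow> 0
   \<and> (\<lambda>n. snd (est n (\<lambda>i. observ (T i w) (C i w) (X i w) (U i w)))) \<longlonglongrightarrow> beta0"
proof -
  interpret prob_space M by (rule P)
  define D where "D = (SUP b\<in>Theta. norm b) + eps0"
  have "bounded (norm ` Theta)"
    using compact_imp_bounded[OF Theta_compact] by (simp add: bounded_norm_comp)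
  then have "norm b \<le> (SUP b\<in>Theta. norm b)" if "b \<in> Theta" for b
    using that by (intro cSUP_upper bounded_imp_bdd_above)
  then have norm_lt: "norm b < D" if "b \<in> Theta" for b
    using that eps0 by (fastforce simp: D_def)
  have L0: "0 \<le> L" and tau0: "0 \<le> tau" using L_pos tau_pos by auto
  note K0 = KlamD[OF true_in_K(1) L0]
  have "\<exists>t\<in>{0..tau}. \<forall>s\<in>{0..tau}. lam0 t \<le> lam0 s"
    using tau0 by (intro continuous_attains_inf K0(2)) auto
  then obtain t0 where t0: "t0 \<in> {0..tau}" "\<And>s. s \<in> {0..tau} \<Longrightarrow> lam0 t0 \<le> lam0 s" by blast
  have int_eq: "integral {0..t} (\<lambda>t. lam0 (clip tau t)) = integral {0..t} lam0" if "t \<in> {0..tau}" for t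
    using that by (intro integral_cong) (auto simp: clip_id)
  interpret cox_sample M X U T C lam0 beta0 tau "lam0 t0" "lam0 0 + L * tau" D L Theta
  proof unfold_locales
    show "X 0 \<in> borel_measurable M" "U 0 \<in> borel_measurable M"
      "T 0 \<in> borel_measurable M" "C 0 \<in> borel_measurable M" by (fact meas)+
    show "integral\<^sup>L M (U 0) = 0" by (fact U_mean)
    show "0 < D" using norm_lt[OF true_in_K(2)] norm_ge_zero[of beta0] by linarith
    show "norm beta0 < D" by (rule norm_lt[OF true_in_K(2)])
    show "integrable M (\<lambda>w. exp (D * norm (U 0 w)))" unfolding D_def by (fact U_mom)
    show "integrable M (\<lambda>w. exp (D * norm (X 0 w)))" unfolding D_def by (fact X_mom)
    show "continuous_on UNIV (\<lambda>t. lam0 (clip tau t))"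
      using clip_in[OF tau0] by (intro continuous_on_compose2[OF K0(2) continuous_clip]) auto
    show "0 < lam0 t0" by (rule lam0_pos[OF t0(1)])
    show "lam0 t0 \<le> lam0 (clip tau t)" for t by (rule t0(2)[OF clip_in[OF tau0]])
    show "lam0 (clip tau t) \<le> lam0 0 + L * tau" for t using K0(3)[OF clip_in[OF tau0, of t]] by linarith
    show "measure M {w \<in> space M. X 0 w \<in> A \<and> T 0 w > t}
       = integral\<^sup>L M (\<lambda>w. indicator A (X 0 w) * exp (- exp (beta0 \<bullet> X 0 w) * integral {0..t} (\<lambda>t. lam0 (clip tau t))))"
      if "A \<in> sets borel" "t \<in> {0..tau}" for A t
      unfolding int_eq[OF that(2)] by (rule cox[OF that])
    show "measure M {w \<in> space M. (T 0 w, X 0 w) \<in> A \<and> C 0 w \<in> B \<and> U 0 w \<in> E}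
       = measure M {w \<in> space M. (T 0 w, X 0 w) \<in> A} * measure M {w \<in> space M. C 0 w \<in> B}
         * measure M {w \<in> space M. U 0 w \<in> E}" if "A \<in> sets borel" "B \<in> sets borel" "E \<in> sets borel" for A B E
      by (rule indep3[OF that])
    show "indep_vars (\<lambda>_. borel) (\<lambda>i w. (X i w, T i w, C i w, U i w)) UNIV" by (fact iid_indep)
    show "distr M borel (\<lambda>w. (X i w, T i w, C i w, U i w)) = distr M borel (\<lambda>w. (X 0 w, T 0 w, C 0 w, U 0 w))" for i
      by (rule iid_dist)
    show "norm b < D" if "b \<in> Theta" for b by (rule norm_lt[OF that])
    show "0 < prob {w \<in> space M. tau - e < C 0 w}" if "0 < e" for e by (rule C_pos[OF that])
  qed (fact | rule C_range)+
  show ?thesis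
    by (rule consistency[OF eps_lim est_K _ true_in_K(2)]) (unfold Q_def, rule est_approx)
qed

end
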